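(* Let $n\ge 1$. There exists a homomorphism (of $R^f$-algebras) $\rho_n^f:R^f[\mathrm{VB}_n]\to\mathrm{VTL}_n(R^f)$ which sends $\sigma_i$ to $-A^{-2}\,1-A^{-4}\,E_i$ and $\tau_i$ to $v_i$ for all $i\in\{1,\dots,n-1\}$.
   Context: $\mathrm{VB}_n$ is the virtual braid group on $n$ strands: the group presented by generators $\sigma_1,\dots,\sigma_{n-1},\tau_1,\dots,\tau_{n-1}$ and relations $\tau_i^2=1$ for $1\le i\le n-1$; $\sigma_i\sigma_j=\sigma_j\sigma_i$, $\tau_i\tau_j=\tau_j\tau_i$, $\tau_i\sigma_j=\sigma_j\tau_i$ for $|i-j|\ge 2$; $\sigma_i\sigma_j\sigma_i=\sigma_j\sigma_i\sigma_j$, $\tau_i\tau_j\tau_i=\tau_j\tau_i\tau_j$, $\tau_i\tau_j\sigma_i=\sigma_j\tau_i\tau_j$ for $|i-j|=1$. $R[\mathrm{VB}_n]$ denotes the group algebra over a ring $R$. Let $R_0^f=\mathbb{Z}[z]$ and $R^f=\mathbb{Z}[A^{\pm1}]$, with $R_0^f$ embedded in $R^f$ via $z=-A^2-A^{-2}$. For $n\ge 1$, a flat virtual $n$-tangle is a partition of $V_n=\{0,1\}\times\{1,\dots,n\}$ into ($n$) pairs; $\mathcal{E}_n$ is the set of flat virtual $n$-tangles. $\mathrm{VTL}_n$ is the free $R_0^f$-module with basis $\mathcal{E}_n$, with the following bilinear multiplication. For $E,E'\in\mathcal{E}_n$, view the pairs as edges (arcs) and concatenate: take disjoint copies of the two and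 glue the point $(1,i)$ of $E$ to the point $(0,i)$ of $E'$ for each $i$. The result consists of $n$ arcs, whose endpoints are the points $(0,i)$ of $E$ and the points $(1,i)$ of $E'$, and some number $m$ of closed curves. The $n$ arcs determine a flat virtual $n$-tangle $E*E'$, and $E\,E'=z^m(E*E')$. This is an associative algebra with unit $\{\{(0,k),(1,k)\}\mid 1\le k\le n\}$. Set $\mathrm{VTL}_n(R^f)=R^f\otimes_{R_0^f}\mathrm{VTL}_n$. For $1\le i\le n-1$: $E_i=\{\{(0,i),(0,i+1)\},\{(1,i),(1,i+1)\}\}\cup\{\{(0,k),(1,k)\}\mid k\ne i,i+1\}$ and $v_i=\{\{(0,i),(1,i+1)\},\{(0,i+1),(1,i)\}\}\cup\{\{(0,k),(1,k)\}\mid k\neq i,i+1\}$. *)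

theory Defs
  imports
    "HOL-Library.Poly_Mapping"
    "HOL-Library.Disjoint_Sets"
    "HOL-Computational_Algebra.Polynomial"
    "HOL-Algebra.QuotRing"
    "HOL-Algebra.Module"
    "HOL-Algebra.Generated_Groups"
begin

section \<open>Groups given by generators and relations\<close>

text \<open>A letter \<open>(True, x)\<close> stands for the generator \<open>x\<close>, a letter \<open>(False, x)\<close> for its formal
  inverse. A relation \<open>l = r\<close> is the pair \<open>(l, r)\<close>.\<close>

type_synonym 'g word = "(bool \<times> 'g) list"

inductive_set pres_cong :: "'g set \<Rightarrow> ('g word \<times> 'g word) set \<Rightarrow> ('g word \<times> 'g word) set"
  for X :: "'g set" and rels :: "('g word \<times> 'g word) set" where
  refl: "w \<in> lists (UNIV \<times> X) \<Longrightarrow> (w, w) \<in> pres_cong X rels"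
| sym: "(u, w) \<in> pres_cong X rels \<Longrightarrow> (w, u) \<in> pres_cong X rels"
| trans: "(u, v) \<in> pres_cong X rels \<Longrightarrow> (v, w) \<in> pres_cong X rels \<Longrightarrow> (u, w) \<in> pres_cong X rels"
| cong: "(u, w) \<in> pres_cong X rels \<Longrightarrow> p \<in> lists (UNIV \<times> X) \<Longrightarrow> q \<in> lists (UNIV \<times> X)
    \<Longrightarrow> (p @ u @ q, p @ w @ q) \<in> pres_cong X rels"
| cancel: "x \<in> X \<Longrightarrow> ([(b, x), (\<not> b, x)], []) \<in> pres_cong X rels"
| rel: "(l, r) \<in> rels \<Longrightarrow> l \<in> lists (UNIV \<times> X) \<Longrightarrow> r \<in> lists (UNIV \<times> X)
    \<Longrightarrow> (l, r) \<in> pres_cong X rels"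

definition presented_group ::
    "'g set \<Rightarrow> ('g word \<times> 'g word) set \<Rightarrow> 'g word set monoid" where
  "presented_group X rels =
    \<lparr>carrier = lists (UNIV \<times> X) // pres_cong X rels,
     mult = (\<lambda>U W. \<Union>u\<in>U. \<Union>w\<in>W. pres_cong X rels `` {u @ w}),
     one = pres_cong X rels `` {[]}\<rparr>"

definition pres_gen :: "'g set \<Rightarrow> ('g word \<times> 'g word) set \<Rightarrow> 'g \<Rightarrow> 'g word set" where
  "pres_gen X rels x = pres_cong X rels `` {[(True, x)]}"


section \<open>The virtual braid group\<close>

datatype vb_gen = Sigma_gen nat | Tau_gen nat

abbreviation sg :: "nat \<Rightarrow> bool \<times> vb_gen" where "sg i \<equiv> (True, Sigma_gen i)"
abbreviation tu :: "nat \<Rightarrow> bool \<times> vb_gen" where "tu i \<equiv> (True, Tau_gen i)"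

definition vb_gens :: "nat \<Rightarrow> vb_gen set" where
  "vb_gens n = Sigma_gen ` {1..n - 1} \<union> Tau_gen ` {1..n - 1}"

definition vb_rels :: "nat \<Rightarrow> (vb_gen word \<times> vb_gen word) set" where
  "vb_rels n =
     {([tu i, tu i], []) | i. i \<in> {1..n - 1}}
   \<union> (\<Union>(i, j) \<in> {(i, j). i \<in> {1..n - 1} \<and> j \<in> {1..n - 1} \<and> \<bar>int i - int j\<bar> \<ge> 2}.
        {([sg i, sg j], [sg j, sg i]),
         ([tu i, tu j], [tu j, tu i]),
         ([tu i, sg j], [sg j, tu i])})
   \<union> (\<Union>(i, j) \<in> {(i, j). i \<in> {1..n - 1} \<and> j \<in> {1..n - 1} \<and> \<bar>int i - int j\<bar> = 1}.
        {([sg i, sg j, sg i], [sg j, sg i, sg j]),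
         ([tu i, tu j, tu i], [tu j, tu i, tu j]),
         ([tu i, tu j, sg i], [sg j, tu i, tu j])})"

definition VB :: "nat \<Rightarrow> vb_gen word set monoid" where
  "VB n = presented_group (vb_gens n) (vb_rels n)"

definition vb_sigma :: "nat \<Rightarrow> nat \<Rightarrow> vb_gen word set" where
  "vb_sigma n i = pres_gen (vb_gens n) (vb_rels n) (Sigma_gen i)"

definition vb_tau :: "nat \<Rightarrow> nat \<Rightarrow> vb_gen word set" where
  "vb_tau n i = pres_gen (vb_gens n) (vb_rels n) (Tau_gen i)"


section \<open>Algebras with a basis\<close>

text \<open>The free module on \<open>B\<close> over the coefficient type, with the bilinear multiplication that sends
  basis elements \<open>x\<close>, \<open>y\<close> to \<open>c x y\<close> times the basis element \<open>p x y\<close>, and unit \<open>e\<close>.\<close>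

definition basis_algebra ::
    "'b set \<Rightarrow> ('b \<Rightarrow> 'b \<Rightarrow> 'b) \<Rightarrow> ('b \<Rightarrow> 'b \<Rightarrow> 'r::comm_ring_1) \<Rightarrow> 'b \<Rightarrow> ('r, 'b \<Rightarrow>\<^sub>0 'r) module" where
  "basis_algebra B p c e =
    \<lparr>carrier = {f. Poly_Mapping.keys f \<subseteq> B},
     mult = (\<lambda>f g. \<Sum>x\<in>Poly_Mapping.keys f. \<Sum>y\<in>Poly_Mapping.keys g.
        Poly_Mapping.single (p x y) (Poly_Mapping.lookup f x * Poly_Mapping.lookup g y * c x y)),
     one = Poly_Mapping.single e 1,
     zero = 0,
     add = (+),
     smult = (\<lambda>r. Poly_Mapping.map ((*) r))\<rparr>"

definition monoid_algebra :: "('g, 'm) monoid_scheme \<Rightarrow> ('r::comm_ring_1, 'g \<Rightarrow>\<^sub>0 'r) module" where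
  "monoid_algebra G = basis_algebra (carrier G) (mult G) (\<lambda>_ _. 1) \<one>\<^bsub>G\<^esub>"

definition algebra_hom :: "('r, 'a, 'p) module_scheme \<Rightarrow> ('r, 'b, 'q) module_scheme \<Rightarrow> ('a \<Rightarrow> 'b) set" where
  "algebra_hom M N =
    {f \<in> ring_hom M N. \<forall>r. \<forall>x\<in>carrier M. f (r \<odot>\<^bsub>M\<^esub> x) = r \<odot>\<^bsub>N\<^esub> f x}"


section \<open>Extension of scalars\<close>

text \<open>For a ring homomorphism \<open>h\<close> from \<open>'r\<close> to \<open>'s\<close> and an \<open>'r\<close>-algebra \<open>M\<close>, the algebra
  \<open>'s \<otimes> M\<close> over \<open>'r\<close> is the free abelian group on all pairs \<open>(s, m)\<close> modulo the subgroup generated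
  by the bilinearity and balancing relations, with product
  \<open>(s \<otimes> m) (s' \<otimes> m') = s s' \<otimes> m m'\<close>. The scalar \<open>s\<close> acts as multiplication by \<open>s \<otimes> 1\<close>.\<close>

definition pair_algebra ::
    "('r, 'm, 'p) module_scheme \<Rightarrow> (int, ('s::comm_ring_1 \<times> 'm) \<Rightarrow>\<^sub>0 int) module" where
  "pair_algebra M =
    basis_algebra (UNIV \<times> carrier M) (\<lambda>(s, x) (t, y). (s * t, x \<otimes>\<^bsub>M\<^esub> y)) (\<lambda>_ _. 1) (1, \<one>\<^bsub>M\<^esub>)"

definition tensor_rels ::
    "('r \<Rightarrow> 's::comm_ring_1) \<Rightarrow> ('r, 'm, 'p) module_scheme \<Rightarrow> (('s \<times> 'm) \<Rightarrow>\<^sub>0 int) set" where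
  "tensor_rels h M =
    (let d = (\<lambda>s x. Poly_Mapping.single (s, x) 1) in
      {d (s + t) x - d s x - d t x | s t x. x \<in> carrier M}
    \<union> {d s (x \<oplus>\<^bsub>M\<^esub> y) - d s x - d s y | s x y. x \<in> carrier M \<and> y \<in> carrier M}
    \<union> {d (s * h r) x - d s (r \<odot>\<^bsub>M\<^esub> x) | s r x. x \<in> carrier M})"

definition tensor_kernel ::
    "('r \<Rightarrow> 's::comm_ring_1) \<Rightarrow> ('r, 'm, 'p) module_scheme \<Rightarrow> (('s \<times> 'm) \<Rightarrow>\<^sub>0 int) set" where
  "tensor_kernel h M = generate (add_monoid (pair_algebra M)) (tensor_rels h M)"

definition pure_tensor ::
    "('r \<Rightarrow> 's::comm_ring_1) \<Rightarrow> ('r, 'm, 'p) module_scheme \<Rightarrow> 's \<Rightarrow> 'm \<Rightarrow> (('s \<times> 'm) \<Rightarrow>\<^sub>0 int) set" where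
  "pure_tensor h M s x = tensor_kernel h M +>\<^bsub>pair_algebra M\<^esub> Poly_Mapping.single (s, x) 1"

definition extend_scalars ::
    "('r \<Rightarrow> 's::comm_ring_1) \<Rightarrow> ('r, 'm, 'p) module_scheme \<Rightarrow> ('s, (('s \<times> 'm) \<Rightarrow>\<^sub>0 int) set) module" where
  "extend_scalars h M =
    (let Q = pair_algebra M Quot tensor_kernel h M in
      \<lparr>carrier = carrier Q, mult = mult Q, one = one Q, zero = zero Q, add = add Q,
       smult = (\<lambda>s X. pure_tensor h M s \<one>\<^bsub>M\<^esub> \<otimes>\<^bsub>Q\<^esub> X)\<rparr>)"


section \<open>The coefficient rings\<close>

text \<open>\<open>\<int>[z]\<close> is \<^typ>\<open>int poly\<close>. The ring \<open>\<int>[A, A\<^sup>-\<^sup>1]\<close> consists of the finitely supported functions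
  from exponents to coefficients, with the convolution product.\<close>

type_synonym laurent = "int \<Rightarrow>\<^sub>0 int"

definition A_pow :: "int \<Rightarrow> laurent" where
  "A_pow k = Poly_Mapping.single k 1"

definition R0_emb :: "int poly \<Rightarrow> laurent" where
  "R0_emb p = poly (map_poly of_int p) (- A_pow 2 - A_pow (-2))"


section \<open>Flat virtual tangles\<close>

type_synonym tangle = "(nat \<times> nat) set set"

definition tangles :: "nat \<Rightarrow> tangle set" where
  "tangles n = {E. partition_on ({0, 1} \<times> {1..n}) E \<and> (\<forall>p\<in>E. card p = 2)}"

text \<open>Concatenation: the glued diagram has vertices \<open>(a, i)\<close> with \<open>a\<close> in \<open>{0, 1, 2}\<close>, where the
  level \<open>a = 1\<close> consists of the glued points. Its connected components are the arcs (those meeting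
  level \<open>0\<close> or \<open>2\<close>) and the closed curves (those contained in level \<open>1\<close>).\<close>

definition glued_edges :: "tangle \<Rightarrow> tangle \<Rightarrow> (nat \<times> nat) set set" where
  "glued_edges E E' = E \<union> (\<lambda>p. (\<lambda>(a, i). (a + 1, i)) ` p) ` E'"

definition components :: "nat \<Rightarrow> tangle \<Rightarrow> tangle \<Rightarrow> (nat \<times> nat) set set" where
  "components n E E' =
    ({0, 1, 2} \<times> {1..n}) // {(x, y). \<exists>p\<in>glued_edges E E'. x \<in> p \<and> y \<in> p}\<^sup>*"

definition outer :: "nat \<Rightarrow> (nat \<times> nat) set" where
  "outer n = {0, 2} \<times> {1..n}"

definition tangle_comp :: "nat \<Rightarrow> tangle \<Rightarrow> tangle \<Rightarrow> tangle" where
  "tangle_comp n E E' =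
    {(\<lambda>(a, i). (if a = 2 then 1 else 0, i)) ` (C \<inter> outer n)
      | C. C \<in> components n E E' \<and> C \<inter> outer n \<noteq> {}}"

definition closed_curves :: "nat \<Rightarrow> tangle \<Rightarrow> tangle \<Rightarrow> nat" where
  "closed_curves n E E' = card {C \<in> components n E E'. C \<inter> outer n = {}}"

definition id_tangle :: "nat \<Rightarrow> tangle" where
  "id_tangle n = {{(0, k), (1, k)} | k. k \<in> {1..n}}"

definition E_tangle :: "nat \<Rightarrow> nat \<Rightarrow> tangle" where
  "E_tangle n i = {{(0, i), (0, i + 1)}, {(1, i), (1, i + 1)}}
    \<union> {{(0, k), (1, k)} | k. k \<in> {1..n} \<and> k \<noteq> i \<and> k \<noteq> i + 1}"

definition v_tangle :: "nat \<Rightarrow> nat \<Rightarrow> tangle" where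
  "v_tangle n i = {{(0, i), (1, i + 1)}, {(0, i + 1), (1, i)}}
    \<union> {{(0, k), (1, k)} | k. k \<in> {1..n} \<and> k \<noteq> i \<and> k \<noteq> i + 1}"


section \<open>The virtual Temperley--Lieb algebra\<close>

definition VTL :: "nat \<Rightarrow> (int poly, tangle \<Rightarrow>\<^sub>0 int poly) module" where
  "VTL n = basis_algebra (tangles n) (tangle_comp n)
    (\<lambda>E E'. [:0, 1:] ^ closed_curves n E E') (id_tangle n)"

definition VTL_Rf ::
    "nat \<Rightarrow> (laurent, ((laurent \<times> (tangle \<Rightarrow>\<^sub>0 int poly)) \<Rightarrow>\<^sub>0 int) set) module" where
  "VTL_Rf n = extend_scalars R0_emb (VTL n)"

definition tangle_elt ::
    "nat \<Rightarrow> tangle \<Rightarrow> ((laurent \<times> (tangle \<Rightarrow>\<^sub>0 int poly)) \<Rightarrow>\<^sub>0 int) set" where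
  "tangle_elt n E = pure_tensor R0_emb (VTL n) 1 (Poly_Mapping.single E 1)"

definition Rf_VB :: "nat \<Rightarrow> (laurent, vb_gen word set \<Rightarrow>\<^sub>0 laurent) module" where
  "Rf_VB n = monoid_algebra (VB n)"

end

theory Submission
  imports Defs
begin

text \<open>
  Colour the end points of a tangle with two colours, and let a tangle act as the 0-1 matrix of those
  colourings that are constant on its pairs.  Summing over the colourings of the glued level gives
  one factor 2 per closed curve, so products of matrices are the concatenations with \<open>z = 2\<close>.
  Since a tangle and an exponent of \<open>z\<close> can be read off from the matrix \<open>2\<^sup>k M(E)\<close>, both the
  associativity of the virtual Temperley--Lieb algebra and all relations between the \<open>E\<^sub>i\<close> and
  \<open>v\<^sub>i\<close> reduce to identities between matrices.  With \<open>a = -A\<^sup>-\<^sup>2\<close>, \<open>b = -A\<^sup>-\<^sup>4\<close>, the braid relation for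
  \<open>a + b E\<^sub>i\<close> follows from \<open>E\<^sub>i E\<^sub>j E\<^sub>i = E\<^sub>i\<close> and \<open>a\<^sup>2 + a b z + b\<^sup>2 = 0\<close>, and the
  inverse of \<open>a + b E\<^sub>i\<close> is obtained by replacing \<open>A\<close> with its inverse.
\<close>

section \<open>Concatenation of tangles\<close>

text \<open>A direct proof of associativity would have to match the components of two iterated
  gluings of three diagrams; with matrices only the gluing of two diagrams needs geometry. Two facts
  about it are required: a component has either no outer point or exactly two, and a colouring of
  the outer points extends over the glued level in \<open>2 ^ m\<close> ways or not at all,
  \<open>m\<close> being the number of closed curves. Two colours suffice although the matrices of
  different tangles become linearly dependent for large \<open>n\<close>: only monomials
  \<open>z^k E\<close> are ever compared, and for these one entry yields \<open>k\<close> and the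
  support yields \<open>E\<close>. Sums enter only afterwards, when the braid relations are derived
  from abstract relations between the \<open>E_i\<close>. The extension of scalars is a literal
  quotient by the tensor relations, so its ring structure has to be established too. The
  multiplicative structure of the target is a monoid, hence the images of the generators need
  explicit two-sided inverses.\<close>

locale glued_tangles =
  fixes n :: nat and E E' :: tangle
  assumes E: "E \<in> tangles n" and E': "E' \<in> tangles n"
begin

definition V :: "(nat \<times> nat) set" where "V = {0, 1, 2} \<times> {1..n}"

definition r :: "((nat \<times> nat) \<times> (nat \<times> nat)) set" where
  "r = {(x, y). \<exists>p\<in>glued_edges E E'. x \<in> p \<and> y \<in> p}"

definition up :: "nat \<times> nat \<Rightarrow> nat \<times> nat" where "up = (\<lambda>(a, i). (a + 1, i))"

lemma components_eq: "components n E E' = V // r\<^sup>*"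
  by (simp add: components_def V_def r_def)

lemma glued_eq: "glued_edges E E' = E \<union> (`) up ` E'"
  by (simp add: glued_edges_def up_def)

lemma inj_up: "inj up"
  by (auto simp: inj_def up_def)

lemma finite_V: "finite V"
  by (simp add: V_def)

lemma union_E: "\<Union>E = {0, 1} \<times> {1..n}" and union_E': "\<Union>E' = {0, 1} \<times> {1..n}"
  using E E' by (auto simp: tangles_def partition_on_def)

lemma union_up_E': "\<Union>((`) up ` E') = {1, 2} \<times> {1..n}"
proof -
  have "\<Union>((`) up ` E') = up ` \<Union>E'" by auto
  also have "\<dots> = {1, 2} \<times> {1..n}"
    unfolding union_E' by (auto simp: up_def image_iff) 
  finally show ?thesis .
qed

lemma union_glued: "\<Union>(glued_edges E E') = V"
  unfolding glued_eq Union_Un_distrib union_E union_up_E' V_def by auto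

lemma card_edge: "p \<in> glued_edges E E' \<Longrightarrow> card p = 2"
  using E E' by (auto simp: glued_eq tangles_def card_image inj_on_subset[OF inj_up])

lemma sym_rtrancl_r: "sym (r\<^sup>*)"
  by (rule sym_rtrancl) (auto simp: sym_def r_def)

lemma r_subset: "r \<subseteq> V \<times> V"
  using union_glued by (auto simp: r_def)

lemma rtrancl_r_in_V: "(x, y) \<in> r\<^sup>* \<Longrightarrow> x \<in> V \<Longrightarrow> y \<in> V"
  by (induction rule: rtrancl_induct) (use r_subset in auto)

lemma component_eq: "C \<in> components n E E' \<Longrightarrow> x \<in> C \<Longrightarrow> C = r\<^sup>* `` {x}"
  using sym_rtrancl_r unfolding components_eq quotient_def
  by (auto dest: symD intro: rtrancl_trans)

lemma component_subset: "C \<in> components n E E' \<Longrightarrow> C \<subseteq> V"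
  by (auto simp: components_eq quotient_def rtrancl_r_in_V)

lemma component_nonempty: "C \<in> components n E E' \<Longrightarrow> C \<noteq> {}"
  by (auto simp: components_eq quotient_def)

lemma component_of: "x \<in> V \<Longrightarrow> \<exists>C\<in>components n E E'. x \<in> C"
  by (auto simp: components_eq quotient_def)

lemma components_disjoint:
  "C \<in> components n E E' \<Longrightarrow> D \<in> components n E E' \<Longrightarrow> x \<in> C \<Longrightarrow> x \<in> D \<Longrightarrow> C = D"
  using component_eq by metis

lemma edge_subset_component:
  assumes "C \<in> components n E E'" "p \<in> glued_edges E E'" "x \<in> p" "x \<in> C"
  shows "p \<subseteq> C"
proof
  fix y assume "y \<in> p"
  then have "(x, y) \<in> r" using assms by (auto simp: r_def)
  then show "y \<in> C" using component_eq[OF assms(1,4)] by auto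
qed

lemma edge_in_component: "p \<in> glued_edges E E' \<Longrightarrow> \<exists>C\<in>components n E E'. p \<subseteq> C"
proof -
  assume p: "p \<in> glued_edges E E'"
  then have "p \<noteq> {}" using card_edge by fastforce
  then obtain x where "x \<in> p" by blast
  moreover then obtain C where "C \<in> components n E E'" "x \<in> C"
    using component_of union_glued p by blast
  ultimately show ?thesis using edge_subset_component p by blast
qed

text \<open>Equality of colours propagates along paths. This trades an edgewise condition for one on
  components, where the free choices can be counted.\<close>

lemma constant_on_components:
  "(\<forall>p\<in>glued_edges E E'. \<forall>x\<in>p. \<forall>y\<in>p. c x = c y)
    \<longleftrightarrow> (\<forall>C\<in>components n E E'. \<forall>x\<in>C. \<forall>y\<in>C. c x = c y)" (is "?L = ?R")
proof
  assume L: ?L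
  have *: "c x = c y" if "(x, y) \<in> r\<^sup>*" for x y
    using that by (induction rule: rtrancl_induct) (use L in \<open>auto simp: r_def\<close>)
  show ?R using component_eq * by blast
next
  assume ?R
  then show ?L using edge_in_component by (meson subsetD)
qed

lemma finite_component: "C \<in> components n E E' \<Longrightarrow> finite C"
  using component_subset finite_V finite_subset by blast

lemma finite_components: "finite (components n E E')"
  by (rule finite_subset[of _ "Pow V"]) (use component_subset finite_V in auto)

lemma finite_glued: "finite (glued_edges E E')"
  by (rule finite_subset[of _ "Pow V"]) (use union_glued finite_V in auto)

text \<open>A connected graph has at most one vertex more than edges: grow a subset of the component
  that satisfies this bound, one crossing edge at a time.\<close>

lemma card_component_le:
  assumes C: "C \<in> components n E E'"
  shows "card C \<le> 1 + card {p \<in> glued_edges E E'. p \<subseteq> C}"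
proof -
  let ?ed = "\<lambda>S. {p \<in> glued_edges E E'. p \<subseteq> S}"
  let ?ok = "\<lambda>S. S \<subseteq> C \<and> S \<noteq> {} \<and> card S \<le> 1 + card (?ed S)"
  obtain x0 where x0: "x0 \<in> C" using component_nonempty[OF C] by auto
  have fin: "finite (Collect ?ok)"
    by (rule finite_subset[of _ "Pow C"]) (use finite_component[OF C] in auto)
  have "{x0} \<in> Collect ?ok" using x0 by auto
  from finite_has_maximal2[OF fin this] obtain S
    where S: "S \<in> Collect ?ok" and max: "\<forall>T\<in>Collect ?ok. S \<le> T \<longrightarrow> S = T"
    by (elim bexE conjE)
  from S have S: "?ok S" by simp
  have "S = C"
  proof (rule ccontr)
    assume "S \<noteq> C"
    then obtain y where y: "y \<in> C" "y \<notin> S" using S by auto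
    obtain x where x: "x \<in> S" using S by auto
    have "(x, y) \<in> r\<^sup>*" using component_eq[OF C, of x] x S y by auto
    then have "\<exists>a b. a \<in> S \<and> b \<notin> S \<and> (a, b) \<in> r"
      using y(2) x by (induction rule: rtrancl_induct) auto
    then obtain a b p where ab: "a \<in> S" "b \<notin> S" and p: "p \<in> glued_edges E E'" "a \<in> p" "b \<in> p"
      by (auto simp: r_def)
    have peq: "p = {a, b}"
    proof -
      obtain u w where "p = {u, w}" using card_edge[OF p(1)] by (auto simp: card_2_iff)
      then show ?thesis using p ab by auto
    qed
    have "p \<subseteq> C" using edge_subset_component[OF C p(1,2)] ab S by auto
    have finS: "finite S" using S finite_component[OF C] finite_subset by blast
    have "card (insert b S) = Suc (card S)" using finS ab by simp
    also have "Suc (card S) \<le> 1 + Suc (card (?ed S))" using S by simp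
    \<comment> \<open>The crossing edge is new because its end \<open>b\<close> lies outside
      \<open>S\<close>: the added vertex is paid for by an added edge.\<close>
    also have "Suc (card (?ed S)) = card (insert p (?ed S))"
    proof -
      have "p \<notin> ?ed S" using p ab by auto
      moreover have "finite (?ed S)" using finite_glued by simp
      ultimately show ?thesis by (rule card_insert_disjoint[symmetric, rotated])
    qed
    also have "\<dots> \<le> card (?ed (insert b S))"
      by (rule card_mono) (use finite_glued p ab peq in auto)
    finally have "?ok (insert b S)" using \<open>p \<subseteq> C\<close> S p by auto
    then show False using max[rule_format, of "insert b S"] ab by (auto simp only: mem_Collect_eq)
  qed
  then show ?thesis using S by simp
qed

text \<open>A pair that meets \<open>W\<close> lies inside \<open>W\<close>, so the covered part of
  \<open>W\<close> is a disjoint union of pairs. It is applied with \<open>W\<close> a component and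
  \<open>P\<close> the edges of one of the two tangles.\<close>

lemma card_pairs_within:
  assumes P: "\<And>p. p \<in> P \<Longrightarrow> card p = 2" "disjoint P" "finite W"
    and closed: "\<And>p x. p \<in> P \<Longrightarrow> x \<in> p \<Longrightarrow> x \<in> W \<Longrightarrow> p \<subseteq> W"
  shows "card (W \<inter> \<Union>P) = 2 * card {p \<in> P. p \<subseteq> W}"
proof -
  have "W \<inter> \<Union>P = \<Union>{p \<in> P. p \<subseteq> W}" using closed by blast
  moreover have "card (\<Union>{p \<in> P. p \<subseteq> W}) = sum card {p \<in> P. p \<subseteq> W}"
    by (rule card_Union_disjoint)
      (use P(2,3) in \<open>auto simp: disjnt_def pairwise_def disjoint_def intro: finite_subset\<close>)
  ultimately show ?thesis using P(1) by simp
qed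

lemma disjoint_E: "disjoint E" and disjoint_up_E': "disjoint ((`) up ` E')"
proof -
  show "disjoint E" using E by (auto simp: tangles_def partition_on_def)
  have "disjoint E'" using E' by (auto simp: tangles_def partition_on_def)
  then show "disjoint ((`) up ` E')"
    by (intro disjoint_image inj_on_subset[OF inj_up]) auto
qed

text \<open>Each tangle is a perfect matching of two adjacent levels, so the points of a component
  on these levels are exactly the ends of that tangle's edges in it.\<close>

lemma card_component_levels:
  assumes C: "C \<in> components n E E'"
  shows "card (C \<inter> {0, 1} \<times> {1..n}) = 2 * card {p \<in> E. p \<subseteq> C}"
    and "card (C \<inter> {1, 2} \<times> {1..n}) = 2 * card {p \<in> (`) up ` E'. p \<subseteq> C}"
proof -
  have g: "p \<in> E \<Longrightarrow> p \<in> glued_edges E E'" "p \<in> (`) up ` E' \<Longrightarrow> p \<in> glued_edges E E'" for p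
    by (auto simp: glued_eq)
  show "card (C \<inter> {0, 1} \<times> {1..n}) = 2 * card {p \<in> E. p \<subseteq> C}"
    unfolding union_E[symmetric]
    by (rule card_pairs_within[OF card_edge[OF g(1)] disjoint_E finite_component[OF C]])
      (use edge_subset_component[OF C g(1)] in blast)+
  show "card (C \<inter> {1, 2} \<times> {1..n}) = 2 * card {p \<in> (`) up ` E'. p \<subseteq> C}"
    unfolding union_up_E'[symmetric]
    by (rule card_pairs_within[OF card_edge[OF g(2)] disjoint_up_E' finite_component[OF C]])
      (use edge_subset_component[OF C g(2)] in blast)+
qed

text \<open>Counting edge ends level by level makes the number of outer points of a component even; the
  bound on the number of vertices makes it at most 2.\<close>

lemma card_component_outer:
  assumes C: "C \<in> components n E E'" and ne: "C \<inter> outer n \<noteq> {}"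
  shows "card (C \<inter> outer n) = 2"
proof -
  have arith: "l0 + l1 = 2 * e \<Longrightarrow> l1 + l2 = 2 * f \<Longrightarrow> l0 + l1 + l2 \<le> 1 + (e + f) \<Longrightarrow> l0 + l2 \<noteq> 0
    \<Longrightarrow> l0 + l2 = 2" for l0 l1 l2 e f :: nat
  proof -
    assume h: "l0 + l1 = 2 * e" "l1 + l2 = 2 * f" "l0 + l1 + l2 \<le> 1 + (e + f)" "l0 + l2 \<noteq> 0"
    \<comment> \<open>Double the third hypothesis and subtract the sum of the first two.\<close>
    have "l0 + l2 \<le> 2" using h by linarith
    moreover have "l0 + l2 + 2 * l1 = 2 * (e + f)" using h(1,2) by simp
    then have "even (l0 + l2)" by (metis dvd_triv_left even_add)
    ultimately show "l0 + l2 = 2" using h(4) by (cases "l0 + l2 = 1") auto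
  qed
  let ?l = "\<lambda>a. card (C \<inter> {a} \<times> {1..n})"
  note fC = finite_component[OF C]
  have split2: "card (C \<inter> {a, b} \<times> {1..n}) = ?l a + ?l b" if "a \<noteq> b" for a b
  proof -
    have "C \<inter> {a, b} \<times> {1..n} = (C \<inter> {a} \<times> {1..n}) \<union> (C \<inter> {b} \<times> {1..n})" by auto
    then show ?thesis using that fC by (simp add: card_Un_disjoint disjoint_iff)
  qed
  have out: "card (C \<inter> outer n) = ?l 0 + ?l 2"
    using split2[of 0 2] by (simp add: outer_def)
  have "C = (C \<inter> {0, 1} \<times> {1..n}) \<union> (C \<inter> {2} \<times> {1..n})"
    using component_subset[OF C] by (auto simp: V_def)
  moreover have "(C \<inter> {0, 1} \<times> {1..n}) \<inter> (C \<inter> {2} \<times> {1..n}) = {}" by auto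
  ultimately have "card C = card (C \<inter> {0, 1} \<times> {1..n}) + ?l 2"
    using fC by (metis card_Un_disjoint finite_Int)
  then have all: "card C = ?l 0 + ?l 1 + ?l 2" using split2[of 0 1] by simp
  have "{p \<in> glued_edges E E'. p \<subseteq> C} = {p \<in> E. p \<subseteq> C} \<union> {p \<in> (`) up ` E'. p \<subseteq> C}"
    by (auto simp: glued_eq)
  \<comment> \<open>Only an inequality: when both tangles join the same two glued points, their
    edges coincide as sets and the closed curve they form carries a single edge.\<close>
  then have "card {p \<in> glued_edges E E'. p \<subseteq> C} \<le> card {p \<in> E. p \<subseteq> C} + card {p \<in> (`) up ` E'. p \<subseteq> C}"
    by (simp only: card_Un_le)
  then have "card C \<le> 1 + (card {p \<in> E. p \<subseteq> C} + card {p \<in> (`) up ` E'. p \<subseteq> C})"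
    using card_component_le[OF C] by linarith
  moreover have "?l 0 + ?l 1 = 2 * card {p \<in> E. p \<subseteq> C}"
    using card_component_levels(1)[OF C] split2[of 0 1] by simp
  moreover have "?l 1 + ?l 2 = 2 * card {p \<in> (`) up ` E'. p \<subseteq> C}"
    using card_component_levels(2)[OF C] split2[of 1 2] by simp
  moreover have "card (C \<inter> outer n) \<noteq> 0" using ne fC by simp
  ultimately show ?thesis
    using out all arith[of "?l 0" "?l 1" _ "?l 2"] by (metis (no_types, lifting))
qed

definition flatten :: "nat \<times> nat \<Rightarrow> nat \<times> nat" where
  "flatten = (\<lambda>(a, i). (if a = 2 then 1 else 0, i))"

lemma tangle_comp_eq:
  "tangle_comp n E E' = (\<lambda>C. flatten ` (C \<inter> outer n)) ` {C \<in> components n E E'. C \<inter> outer n \<noteq> {}}"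
  by (auto simp: tangle_comp_def flatten_def)

lemma inj_on_flatten: "inj_on flatten (outer n)"
  by (auto simp: inj_on_def flatten_def outer_def)

lemma flatten_outer: "flatten ` outer n = {0, 1} \<times> {1..n}"
  by (auto simp: flatten_def outer_def image_iff)

lemma outer_subset: "outer n \<subseteq> V"
  by (auto simp: outer_def V_def)

text \<open>Components are disjoint and \<open>flatten\<close> is injective on the outer points, so
  the traces of the components form a partition; that its blocks are pairs is
  \<open>card_component_outer\<close>.\<close>

lemma tangle_comp_closed: "tangle_comp n E E' \<in> tangles n"
  unfolding tangles_def mem_Collect_eq
proof (intro conjI ballI)
  show "partition_on ({0, 1} \<times> {1..n}) (tangle_comp n E E')"
  proof (rule partition_onI)
    have "\<Union>(tangle_comp n E E') = flatten ` outer n"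
      using component_of outer_subset unfolding tangle_comp_eq by fast
    then show "\<Union>(tangle_comp n E E') = {0, 1} \<times> {1..n}"
      by (simp add: flatten_outer)
  next
    fix p q assume "p \<in> tangle_comp n E E'" "q \<in> tangle_comp n E E'" "p \<noteq> q"
    then obtain C D where CD: "C \<in> components n E E'" "D \<in> components n E E'"
      and pq: "p = flatten ` (C \<inter> outer n)" "q = flatten ` (D \<inter> outer n)" and "C \<noteq> D"
      unfolding tangle_comp_eq by blast
    then have "(C \<inter> outer n) \<inter> (D \<inter> outer n) = {}" using components_disjoint by blast
    then show "disjnt p q"
      unfolding pq disjnt_def using inj_on_flatten
      by (metis inj_on_image_Int image_empty inf_le2)
  qed (auto simp: tangle_comp_eq)
next
  fix p assume "p \<in> tangle_comp n E E'"
  then obtain C where C: "C \<in> components n E E'" "C \<inter> outer n \<noteq> {}"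
    and p: "p = flatten ` (C \<inter> outer n)"
    unfolding tangle_comp_eq by blast
  have "card p = card (C \<inter> outer n)"
    unfolding p by (rule card_image) (rule inj_on_subset[OF inj_on_flatten], simp)
  then show "card p = 2" using card_component_outer[OF C] by simp
qed


end

section \<open>Two-colourings of tangles\<close>

text \<open>A colouring of a level is the set of points that get the first colour.  The 0-1 matrix of
  compatibility is the image of a tangle under the representation of the Brauer algebra of
  parameter 2 on the tensor power of a two-dimensional space.\<close>

definition colour :: "nat set \<Rightarrow> nat set \<Rightarrow> nat \<times> nat \<Rightarrow> bool" where
  "colour X Y = (\<lambda>(a, i). i \<in> (if a = 0 then X else Y))"

definition compatible :: "tangle \<Rightarrow> nat set \<Rightarrow> nat set \<Rightarrow> bool" where
  "compatible E X Y \<longleftrightarrow> (\<forall>p\<in>E. \<forall>x\<in>p. \<forall>y\<in>p. colour X Y x = colour X Y y)"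

context glued_tangles
begin

definition colour3 :: "nat set \<Rightarrow> nat set \<Rightarrow> nat set \<Rightarrow> nat \<times> nat \<Rightarrow> bool" where
  "colour3 X Z Y = (\<lambda>(a, i). i \<in> (if a = 0 then X else if a = 1 then Z else Y))"

text \<open>A glued point has the colour prescribed by \<open>Z\<close> whether it is seen from
  \<open>E\<close> or from \<open>E'\<close>, so the two compatibilities together say that one
  three-level colouring is constant along every edge.\<close>

lemma compatible_glued:
  "compatible E X Z \<and> compatible E' Z Y \<longleftrightarrow>
    (\<forall>C\<in>components n E E'. \<forall>x\<in>C. \<forall>y\<in>C. colour3 X Z Y x = colour3 X Z Y y)"
proof -
  have 1: "colour X Z x = colour3 X Z Y x" if "p \<in> E" "x \<in> p" for p x
  proof -
    have "x \<in> {0, 1} \<times> {1..n}" using that union_E by blast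
    then show ?thesis by (auto simp: colour_def colour3_def)
  qed
  have 2: "colour Z Y x = colour3 X Z Y (up x)" if "p \<in> E'" "x \<in> p" for p x
  proof -
    have "x \<in> {0, 1} \<times> {1..n}" using that union_E' by blast
    then show ?thesis by (auto simp: colour_def colour3_def up_def)
  qed
  have "compatible E X Z \<longleftrightarrow> (\<forall>p\<in>E. \<forall>x\<in>p. \<forall>y\<in>p. colour3 X Z Y x = colour3 X Z Y y)"
    unfolding compatible_def using 1 by metis
  moreover have "compatible E' Z Y
      \<longleftrightarrow> (\<forall>p\<in>(`) up ` E'. \<forall>x\<in>p. \<forall>y\<in>p. colour3 X Z Y x = colour3 X Z Y y)"
    unfolding compatible_def ball_simps using 2 by metis
  ultimately show ?thesis
    unfolding constant_on_components[symmetric] glued_eq ball_Un by simp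
qed

text \<open>Outer points do not see the glued level, so the middle colouring \<open>Z\<close> is
  arbitrary here. It is left free in order to match \<open>compatible_glued\<close> for any
  \<open>Z\<close>.\<close>

lemma compatible_tangle_comp:
  "compatible (tangle_comp n E E') X Y \<longleftrightarrow>
    (\<forall>C\<in>components n E E'. \<forall>x\<in>C \<inter> outer n. \<forall>y\<in>C \<inter> outer n. colour3 X Z Y x = colour3 X Z Y y)"
proof -
  have *: "colour X Y (flatten x) = colour3 X Z Y x" if "x \<in> outer n" for x
    using that by (auto simp: colour_def colour3_def flatten_def outer_def)
  have "compatible (tangle_comp n E E') X Y \<longleftrightarrow> (\<forall>C\<in>{C \<in> components n E E'. C \<inter> outer n \<noteq> {}}.
      \<forall>x\<in>C \<inter> outer n. \<forall>y\<in>C \<inter> outer n. colour X Y (flatten x) = colour X Y (flatten y))"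
    unfolding compatible_def tangle_comp_eq ball_simps ..
  also have "\<dots> \<longleftrightarrow> (\<forall>C\<in>components n E E'.
      \<forall>x\<in>C \<inter> outer n. \<forall>y\<in>C \<inter> outer n. colour X Y (flatten x) = colour X Y (flatten y))"
    by blast
  finally show ?thesis using * by (metis (no_types, lifting) IntD2)
qed

text \<open>The outer colours force the colour of every glued point on an arc, while each closed
  curve can take either colour independently. The count is a bijection between sets of closed curves
  and admissible colourings of the glued level.\<close>

lemma card_compatible:
  assumes X: "X \<subseteq> {1..n}" and Y: "Y \<subseteq> {1..n}"
  shows "card {Z \<in> Pow {1..n}. compatible E X Z \<and> compatible E' Z Y} =
    (if compatible (tangle_comp n E E') X Y then 2 ^ closed_curves n E E' else 0)"
proof (cases "compatible (tangle_comp n E E') X Y")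
  case False
  then have "\<not> (compatible E X Z \<and> compatible E' Z Y)" for Z
    unfolding compatible_glued compatible_tangle_comp[of X Y Z] by blast
  then have "{Z \<in> Pow {1..n}. compatible E X Z \<and> compatible E' Z Y} = {}" by blast
  then show ?thesis using False by simp
next
  case True
  define Cs where "Cs = {C \<in> components n E E'. C \<inter> outer n = {}}"
  define S where "S = {Z \<in> Pow {1..n}. compatible E X Z \<and> compatible E' Z Y}"
  \<comment> \<open>The arcs whose ends have the first colour. The empty middle colouring is a
    placeholder, as only outer points are tested.\<close>
  define T where "T = {C \<in> components n E E'. \<exists>x\<in>C \<inter> outer n. colour3 X {} Y x}"
  \<comment> \<open>\<open>F D\<close> gives the first colour to the glued points on the closed
    curves in \<open>D\<close> and on the arcs in \<open>T\<close>; \<open>G\<close> reads the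
    chosen closed curves back off a colouring.\<close>
  define F where "F D = {i. (1, i) \<in> \<Union>(D \<union> T)}" for D
  define G where "G Z = {C \<in> Cs. C \<subseteq> {1} \<times> Z}" for Z
  have outer_colour3: "colour3 X Z Y x = colour3 X Z' Y x" if "x \<in> outer n" for x Z Z'
    using that by (auto simp: colour3_def outer_def)
  have T_sub: "T \<subseteq> components n E E'" by (auto simp: T_def)
  have T_iff: "C \<in> T \<longleftrightarrow> colour3 X {} Y x"
    if "C \<in> components n E E'" "x \<in> C" "x \<in> outer n" for C x
    using True that unfolding compatible_tangle_comp[of X Y "{}"] T_def by blast
  have closed_levels: "C \<subseteq> {1} \<times> {1..n}" if "C \<in> Cs" for C
    using that component_subset[of C] by (auto simp: Cs_def outer_def V_def)
  have F_colour: "colour3 X (F D) Y x \<longleftrightarrow> x \<in> \<Union>(D \<union> T)" if D: "D \<subseteq> Cs" and x: "x \<in> V" for D x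
  proof (cases "x \<in> outer n")
    case False
    then obtain i where "x = (1, i)" using x by (auto simp: V_def outer_def)
    then show ?thesis by (simp add: colour3_def F_def)
  next
    case out: True
    obtain C where C: "C \<in> components n E E'" "x \<in> C" using component_of x by blast
    have "x \<notin> \<Union>D" using D out by (auto simp: Cs_def)
    moreover have "x \<in> \<Union>T \<longleftrightarrow> C \<in> T"
      using C components_disjoint T_sub by blast
    moreover have "C \<in> T \<longleftrightarrow> colour3 X {} Y x" using T_iff C out by blast
    ultimately show ?thesis using outer_colour3[OF out] by auto
  qed
  have F_in: "F D \<in> S" if D: "D \<subseteq> Cs" for D
  proof -
    have DT: "D \<union> T \<subseteq> components n E E'" using D by (auto simp: Cs_def T_def)
    have "F D \<subseteq> {1..n}"
    proof
      fix i assume "i \<in> F D"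
      then have "(1, i) \<in> V" using DT component_subset by (auto simp: F_def)
      then show "i \<in> {1..n}" by (simp add: V_def)
    qed
    moreover have "colour3 X (F D) Y x = colour3 X (F D) Y y"
      if C: "C \<in> components n E E'" "x \<in> C" "y \<in> C" for C x y
    proof -
      have "x \<in> V" "y \<in> V" using C component_subset by auto
      moreover have "x \<in> \<Union>(D \<union> T) \<longleftrightarrow> C \<in> D \<union> T" "y \<in> \<Union>(D \<union> T) \<longleftrightarrow> C \<in> D \<union> T"
        using C DT components_disjoint by blast+
      ultimately show ?thesis using F_colour[OF D] by simp
    qed
    ultimately show ?thesis unfolding S_def compatible_glued by blast
  qed
  have GF: "G (F D) = D" if D: "D \<subseteq> Cs" for D
  proof -
    have "C \<subseteq> {1} \<times> F D \<longleftrightarrow> C \<in> D" if C: "C \<in> Cs" for C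
    proof
      assume "C \<in> D"
      then show "C \<subseteq> {1} \<times> F D" using closed_levels[OF C] by (auto simp: F_def)
    next
      assume sub: "C \<subseteq> {1} \<times> F D"
      have Cc: "C \<in> components n E E'" using C by (simp add: Cs_def)
      then obtain x where "x \<in> C" using component_nonempty by blast
      then have "x \<in> \<Union>(D \<union> T)" using sub by (auto simp: F_def)
      then obtain C' where C': "C' \<in> D \<union> T" "x \<in> C'" by blast
      have "C' \<in> components n E E'" using C' D by (auto simp: Cs_def T_def)
      then have "C' = C" using components_disjoint Cc C' \<open>x \<in> C\<close> by blast
      moreover have "C \<notin> T" using C by (auto simp: Cs_def T_def)
      ultimately show "C \<in> D" using C' by auto
    qed
    then show ?thesis using D by (auto simp: G_def)
  qed
  have FG: "F (G Z) = Z" if Z: "Z \<in> S" for Z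
  proof -
    have const: "colour3 X Z Y x = colour3 X Z Y y" if "C \<in> components n E E'" "x \<in> C" "y \<in> C" for C x y
      using Z that unfolding S_def compatible_glued by blast
    have Zn: "Z \<subseteq> {1..n}" using Z by (simp add: S_def)
    have "i \<in> F (G Z) \<longleftrightarrow> i \<in> Z" if i: "i \<in> {1..n}" for i
    proof -
      have "(1, i) \<in> V" using i by (simp add: V_def)
      then obtain C where C: "C \<in> components n E E'" "(1, i) \<in> C" using component_of by blast
      have GT: "G Z \<union> T \<subseteq> components n E E'" by (auto simp: G_def Cs_def T_def)
      have "i \<in> F (G Z) \<longleftrightarrow> C \<in> G Z \<union> T"
        unfolding F_def using C GT components_disjoint by blast
      also have "\<dots> \<longleftrightarrow> i \<in> Z"
      \<comment> \<open>On a closed curve the colour is recorded by \<open>G\<close>; on an arc the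
        glued point has the colour of an outer end, which \<open>T\<close> records.\<close>
      proof (cases "C \<inter> outer n = {}")
        case True
        then have CCs: "C \<in> Cs" using C by (simp add: Cs_def)
        have "C \<subseteq> {1} \<times> Z \<longleftrightarrow> i \<in> Z"
        proof
          assume "i \<in> Z"
          then have "colour3 X Z Y (1, i)" by (simp add: colour3_def)
          then have "\<forall>x\<in>C. colour3 X Z Y x" using const C by blast
          then show "C \<subseteq> {1} \<times> Z" using closed_levels[OF CCs] by (fastforce simp: colour3_def)
        qed (use C in auto)
        then show ?thesis using CCs True by (auto simp: G_def T_def)
      next
        case False
        then obtain x where x: "x \<in> C" "x \<in> outer n" by blast
        have "C \<notin> G Z" using False by (auto simp: G_def Cs_def)
        moreover have "C \<in> T \<longleftrightarrow> colour3 X {} Y x" using T_iff C x by blast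
        moreover have "colour3 X {} Y x = colour3 X Z Y x" using x outer_colour3 by blast
        moreover have "\<dots> = colour3 X Z Y (1, i)" using const C x by blast
        ultimately show ?thesis by (auto simp: colour3_def)
      qed
      finally show ?thesis .
    qed
    moreover have "F (G Z) \<subseteq> {1..n}"
      using F_in[of "G Z"] by (auto simp: S_def G_def)
    ultimately show ?thesis using Zn by blast
  qed
  have "bij_betw F (Pow Cs) S"
    by (rule bij_betw_byWitness[where f' = G]) (use GF FG F_in in \<open>auto simp: G_def\<close>)
  then have "card S = card (Pow Cs)" by (simp add: bij_betw_same_card)
  also have "\<dots> = 2 ^ card Cs"
    by (rule card_Pow) (use finite_components in \<open>simp add: Cs_def\<close>)
  finally show ?thesis using True by (simp add: S_def Cs_def closed_curves_def)
qed

end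

text \<open>Test with the colouring that gives the first colour exactly to the points of one pair
  \<open>p\<close> of \<open>E\<close>. As \<open>F\<close> is compatible with it too, the pair of
  \<open>F\<close> through a point of \<open>p\<close> cannot leave \<open>p\<close>, and equal
  cardinality makes the two pairs equal.\<close>

lemma compatible_subset:
  assumes E: "E \<in> tangles n" and F: "F \<in> tangles n"
    and imp: "\<And>X Y. X \<subseteq> {1..n} \<Longrightarrow> Y \<subseteq> {1..n} \<Longrightarrow> compatible E X Y \<Longrightarrow> compatible F X Y"
  shows "E \<subseteq> F"
proof
  fix p assume p: "p \<in> E"
  have U: "\<Union>E = {0, 1} \<times> {1..n}" "\<Union>F = {0, 1} \<times> {1..n}" and dis: "disjoint E"
    and c2: "\<And>q. q \<in> E \<Longrightarrow> card q = 2" "\<And>q. q \<in> F \<Longrightarrow> card q = 2"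
    using E F by (auto simp: tangles_def partition_on_def)
  define X Y where "X = {i. (0, i) \<in> p}" and "Y = {i. (1, i) \<in> p}"
  have pV: "p \<subseteq> {0, 1} \<times> {1..n}" using U(1) p by blast
  have XY: "X \<subseteq> {1..n}" "Y \<subseteq> {1..n}" using pV by (auto simp: X_def Y_def)
  have col: "colour X Y x \<longleftrightarrow> x \<in> p" if "x \<in> {0, 1} \<times> {1..n}" for x
    using that by (auto simp: colour_def X_def Y_def)
  have "compatible E X Y"
    unfolding compatible_def
  proof (intro ballI)
    fix q x y assume q: "q \<in> E" "x \<in> q" "y \<in> q"
    then have "x \<in> p \<longleftrightarrow> y \<in> p" using dis p by (auto simp: disjoint_def)
    then show "colour X Y x = colour X Y y" using col U q by blast
  qed
  then have cF: "compatible F X Y" using imp XY by blast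
  have "p \<noteq> {}" using c2(1)[OF p] by auto
  then obtain x where x: "x \<in> p" by blast
  then obtain q where q: "q \<in> F" "x \<in> q" using pV U by blast
  have "q \<subseteq> p"
  proof
    fix y assume "y \<in> q"
    then have "colour X Y y = colour X Y x" using cF q unfolding compatible_def by blast
    moreover have "y \<in> {0, 1} \<times> {1..n}" using U(2) q(1) \<open>y \<in> q\<close> by blast
    moreover have "x \<in> {0, 1} \<times> {1..n}" using pV x by blast
    ultimately show "y \<in> p" using col x by simp
  qed
  moreover have "finite p" using c2(1)[OF p] by (simp add: card_ge_0_finite)
  ultimately have "q = p" using c2(1)[OF p] c2(2)[OF q(1)] card_subset_eq by metis
  then show "p \<in> F" using q by simp
qed

section \<open>Matrices indexed by colourings\<close>

definition mmul :: "nat \<Rightarrow> (nat set \<Rightarrow> nat set \<Rightarrow> nat) \<Rightarrow> (nat set \<Rightarrow> nat set \<Rightarrow> nat) \<Rightarrow> nat set \<Rightarrow> nat set \<Rightarrow> nat"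
  where "mmul n A B X Y = (\<Sum>Z\<in>Pow {1..n}. A X Z * B Z Y)"

lemma mmul_assoc: "mmul n (mmul n A B) C = mmul n A (mmul n B C)"
proof (intro ext)
  fix X Y
  have "mmul n (mmul n A B) C X Y = (\<Sum>Z\<in>Pow {1..n}. \<Sum>W\<in>Pow {1..n}. A X W * B W Z * C Z Y)"
    by (simp add: mmul_def sum_distrib_right)
  also have "\<dots> = (\<Sum>W\<in>Pow {1..n}. \<Sum>Z\<in>Pow {1..n}. A X W * B W Z * C Z Y)"
    by (rule sum.swap)
  also have "\<dots> = mmul n A (mmul n B C) X Y"
    by (simp add: mmul_def sum_distrib_left mult.assoc)
  finally show "mmul n (mmul n A B) C X Y = mmul n A (mmul n B C) X Y" .
qed

lemma mmul_of_bool: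
  "mmul n (\<lambda>X Z. of_bool (P X Z)) (\<lambda>Z Y. of_bool (Q Z Y)) X Y = card {Z \<in> Pow {1..n}. P X Z \<and> Q Z Y}"
proof -
  have "(\<Sum>Z\<in>Pow {1..n}. of_bool (P X Z) * of_bool (Q Z Y)) = (\<Sum>Z\<in>Pow {1..n}. if P X Z \<and> Q Z Y then 1 else 0 :: nat)"
    by (intro sum.cong) auto
  also have "\<dots> = card {Z \<in> Pow {1..n}. P X Z \<and> Q Z Y}"
    by (subst sum.inter_filter[symmetric]) auto
  finally show ?thesis by (simp add: mmul_def)
qed

text \<open>For products without closed curves: the intermediate colouring is forced, so the matrix
  product is again 0-1.\<close>

lemma mmul_of_bool_unique:
  assumes "\<And>Z. Z \<subseteq> {1..n} \<Longrightarrow> P X Z \<and> Q Z Y \<longleftrightarrow> R \<and> Z = W" and "W \<subseteq> {1..n}"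
  shows "mmul n (\<lambda>X Z. of_bool (P X Z)) (\<lambda>Z Y. of_bool (Q Z Y)) X Y = of_bool R"
proof -
  have "{Z \<in> Pow {1..n}. P X Z \<and> Q Z Y} = (if R then {W} else {})"
    using assms by auto
  then show ?thesis by (simp add: mmul_of_bool)
qed

text \<open>The monomial \<open>z\<^sup>k E\<close> of the virtual Temperley--Lieb algebra acts as the matrix \<open>A\<close>,
  the variable \<open>z\<close> being specialised to the number 2 of colours.\<close>

definition represents :: "nat \<Rightarrow> nat \<Rightarrow> tangle \<Rightarrow> (nat set \<Rightarrow> nat set \<Rightarrow> nat) \<Rightarrow> bool" where
  "represents n k E A \<longleftrightarrow> E \<in> tangles n \<and>
    (\<forall>X\<in>Pow {1..n}. \<forall>Y\<in>Pow {1..n}. A X Y = 2 ^ k * of_bool (compatible E X Y))"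

text \<open>Multiplicativity of the matrix representation: the sum over intermediate colourings is
  the count of \<open>card_compatible\<close>, and the powers of 2 add up like the exponents of
  \<open>z\<close>.\<close>

lemma represents_mult:
  assumes A: "represents n k E A" and B: "represents n l F B"
  shows "represents n (k + l + closed_curves n E F) (tangle_comp n E F) (mmul n A B)"
proof -
  interpret glued_tangles n E F
    using A B by unfold_locales (auto simp: represents_def)
  have "mmul n A B X Y = 2 ^ (k + l + closed_curves n E F) * of_bool (compatible (tangle_comp n E F) X Y)"
    if XY: "X \<in> Pow {1..n}" "Y \<in> Pow {1..n}" for X Y
  proof -
    have "mmul n A B X Y =
        (\<Sum>Z\<in>Pow {1..n}. 2 ^ (k + l) * (of_bool (compatible E X Z) * of_bool (compatible F Z Y)))"
      unfolding mmul_def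
      by (rule sum.cong) (use A B XY in \<open>auto simp: represents_def power_add\<close>)
    also have "\<dots> = 2 ^ (k + l) *
        mmul n (\<lambda>X Z. of_bool (compatible E X Z)) (\<lambda>Z Y. of_bool (compatible F Z Y)) X Y"
      by (simp only: mmul_def sum_distrib_left)
    also have "\<dots> = 2 ^ (k + l) *
        (if compatible (tangle_comp n E F) X Y then 2 ^ closed_curves n E F else 0)"
      unfolding mmul_of_bool using card_compatible XY by simp
    finally show ?thesis by (simp add: power_add)
  qed
  then show ?thesis using tangle_comp_closed by (simp add: represents_def)
qed

text \<open>Monochromatic boundary colourings are compatible with every tangle, so the entry at
  \<open>{}\<close>, \<open>{}\<close> is \<open>2 ^ k\<close> and determines \<open>k\<close>.
  After cancelling this factor the supports agree, and \<open>compatible_subset\<close> in both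
  directions identifies the tangles.\<close>

lemma represents_unique:
  assumes A: "represents n k E A" and B: "represents n l F B"
    and eq: "\<And>X Y. X \<subseteq> {1..n} \<Longrightarrow> Y \<subseteq> {1..n} \<Longrightarrow> A X Y = B X Y"
  shows "k = l \<and> E = F"
proof -
  have *: "2 ^ k * of_bool (compatible E X Y) = (2 ^ l * of_bool (compatible F X Y) :: nat)"
    if "X \<subseteq> {1..n}" "Y \<subseteq> {1..n}" for X Y
    using A B eq[OF that] that by (auto simp: represents_def)
  have triv: "compatible G {} {}" for G
    by (auto simp: compatible_def colour_def)
  have "k = l" using *[of "{}" "{}"] triv by simp
  moreover have "compatible E X Y \<longleftrightarrow> compatible F X Y" if "X \<subseteq> {1..n}" "Y \<subseteq> {1..n}" for X Y
    using *[OF that] by (cases "compatible E X Y"; cases "compatible F X Y") auto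
  then have "E = F"
    using A B compatible_subset[of E n F] compatible_subset[of F n E] unfolding represents_def by blast
  ultimately show ?thesis by simp
qed

lemma represents_tangle: "E \<in> tangles n \<Longrightarrow> represents n 0 E (\<lambda>X Y. of_bool (compatible E X Y))"
  by (simp add: represents_def)

section \<open>The matrices of the tangles \<open>E_i\<close> and \<open>v_i\<close>\<close>

text \<open>Stated for arbitrary points \<open>a\<close>, \<open>b\<close> instead of
  \<open>i\<close>, \<open>i + 1\<close>, so that neighbouring indices in either order become one
  situation with a shared point.\<close>

definition cup_cap :: "nat \<Rightarrow> nat \<Rightarrow> nat set \<Rightarrow> nat set \<Rightarrow> bool" where
  "cup_cap a b X Y \<longleftrightarrow> (a \<in> X \<longleftrightarrow> b \<in> X) \<and> (a \<in> Y \<longleftrightarrow> b \<in> Y) \<and>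
    (\<forall>k. k \<noteq> a \<longrightarrow> k \<noteq> b \<longrightarrow> (k \<in> X \<longleftrightarrow> k \<in> Y))"

definition swap_set :: "nat \<Rightarrow> nat \<Rightarrow> nat set \<Rightarrow> nat set" where
  "swap_set a b X = {k. (if k = a then b else if k = b then a else k) \<in> X}"

lemma mem_swap_set:
  "k \<in> swap_set a b X \<longleftrightarrow> (if k = a then b \<in> X else if k = b then a \<in> X else k \<in> X)"
  by (simp add: swap_set_def)

lemma Union_through: "\<Union>{{(0::nat, k), (1::nat, k)} |k. P k} = {0, 1} \<times> {k::nat. P k}"
  unfolding setcompr_eq_image by auto

lemma id_tangle_in: "id_tangle n \<in> tangles n"
  unfolding tangles_def mem_Collect_eq
proof (intro conjI ballI)
  show "partition_on ({0, 1} \<times> {1..n}) (id_tangle n)"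
  proof (rule partition_onI)
    show "\<Union>(id_tangle n) = {0, 1} \<times> {1..n}"
      unfolding id_tangle_def Union_through by auto
  qed (auto simp: id_tangle_def disjnt_def)
qed (auto simp: id_tangle_def)

lemma E_tangle_in: "i \<in> {1..n - 1} \<Longrightarrow> E_tangle n i \<in> tangles n"
  unfolding tangles_def mem_Collect_eq
proof (intro conjI ballI)
  assume i: "i \<in> {1..n - 1}"
  show "partition_on ({0, 1} \<times> {1..n}) (E_tangle n i)"
  proof (rule partition_onI)
    show "\<Union>(E_tangle n i) = {0, 1} \<times> {1..n}"
      using i unfolding E_tangle_def Union_Un_distrib Union_through by auto
  qed (auto simp: E_tangle_def disjnt_def)
qed (auto simp: E_tangle_def)

lemma v_tangle_in: "i \<in> {1..n - 1} \<Longrightarrow> v_tangle n i \<in> tangles n"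
  unfolding tangles_def mem_Collect_eq
proof (intro conjI ballI)
  assume i: "i \<in> {1..n - 1}"
  show "partition_on ({0, 1} \<times> {1..n}) (v_tangle n i)"
  proof (rule partition_onI)
    show "\<Union>(v_tangle n i) = {0, 1} \<times> {1..n}"
      using i unfolding v_tangle_def Union_Un_distrib Union_through by auto
  qed (auto simp: v_tangle_def disjnt_def)
qed (auto simp: v_tangle_def)

lemma compatible_through:
  "compatible {{(0, k), (1, k)} |k. P k} X Y \<longleftrightarrow> (\<forall>k. P k \<longrightarrow> (k \<in> X \<longleftrightarrow> k \<in> Y))"
  unfolding compatible_def setcompr_eq_image ball_simps by (auto simp: colour_def)

lemma compatible_Un: "compatible (E \<union> F) X Y \<longleftrightarrow> compatible E X Y \<and> compatible F X Y"
  by (auto simp: compatible_def)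

lemma represents_id: "represents n 0 (id_tangle n) (\<lambda>X Y. of_bool (X = Y))"
proof -
  have "compatible (id_tangle n) X Y \<longleftrightarrow> X = Y" if "X \<subseteq> {1..n}" "Y \<subseteq> {1..n}" for X Y
    using that unfolding id_tangle_def compatible_through by blast
  then show ?thesis by (simp add: represents_def id_tangle_in)
qed

lemma represents_E:
  assumes i: "i \<in> {1..n - 1}"
  shows "represents n 0 (E_tangle n i) (\<lambda>X Y. of_bool (cup_cap i (i + 1) X Y))"
proof -
  have "compatible (E_tangle n i) X Y \<longleftrightarrow> cup_cap i (i + 1) X Y"
    if "X \<subseteq> {1..n}" "Y \<subseteq> {1..n}" for X Y
  proof -
    have "compatible {{(0, i), (0, i + 1)}, {(1, i), (1, i + 1)}} X Y
        \<longleftrightarrow> (i \<in> X \<longleftrightarrow> i + 1 \<in> X) \<and> (i \<in> Y \<longleftrightarrow> i + 1 \<in> Y)"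
      by (auto simp: compatible_def colour_def)
    then show ?thesis
      using that unfolding E_tangle_def compatible_Un compatible_through cup_cap_def by blast
  qed
  then show ?thesis using E_tangle_in[OF i] by (simp add: represents_def)
qed

lemma represents_v:
  assumes i: "i \<in> {1..n - 1}"
  shows "represents n 0 (v_tangle n i) (\<lambda>X Y. of_bool (Y = swap_set i (i + 1) X))"
proof -
  have "compatible (v_tangle n i) X Y \<longleftrightarrow> Y = swap_set i (i + 1) X"
    if "X \<subseteq> {1..n}" "Y \<subseteq> {1..n}" for X Y
  proof -
    have "compatible {{(0, i), (1, i + 1)}, {(0, i + 1), (1, i)}} X Y
        \<longleftrightarrow> (i \<in> X \<longleftrightarrow> i + 1 \<in> Y) \<and> (i + 1 \<in> X \<longleftrightarrow> i \<in> Y)"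
      by (auto simp: compatible_def colour_def)
    then have "compatible (v_tangle n i) X Y \<longleftrightarrow> (i \<in> X \<longleftrightarrow> i + 1 \<in> Y) \<and> (i + 1 \<in> X \<longleftrightarrow> i \<in> Y) \<and>
        (\<forall>k. k \<noteq> i \<longrightarrow> k \<noteq> i + 1 \<longrightarrow> (k \<in> X \<longleftrightarrow> k \<in> Y))"
      using that unfolding v_tangle_def compatible_Un compatible_through by blast
    also have "\<dots> \<longleftrightarrow> Y = swap_set i (i + 1) X"
      unfolding set_eq_iff mem_swap_set by (smt (verit))
    finally show ?thesis .
  qed
  then show ?thesis using v_tangle_in[OF i] by (simp add: represents_def)
qed

lemma swap_set_subset: "a \<in> N \<Longrightarrow> b \<in> N \<Longrightarrow> X \<subseteq> N \<Longrightarrow> swap_set a b X \<subseteq> N"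
  by (auto simp: swap_set_def split: if_splits)

lemma swap_set_swap_set [simp]: "swap_set a b (swap_set a b X) = X"
  by (auto simp: swap_set_def)

lemma swap_set_commute: "swap_set a b = swap_set b a"
  by (auto simp: swap_set_def fun_eq_iff)

lemma cup_cap_commute: "cup_cap a b = cup_cap b a"
  by (auto simp: cup_cap_def fun_eq_iff)

text \<open>The matrix of a swap is a permutation matrix: the sum over intermediate colourings has
  one nonzero term, and multiplication becomes a substitution of the argument.\<close>

lemma mmul_swap_left:
  assumes "a \<in> {1..n}" "b \<in> {1..n}" "X \<subseteq> {1..n}"
  shows "mmul n (\<lambda>X Y. of_bool (Y = swap_set a b X)) B X Y = B (swap_set a b X) Y"
proof -
  have "mmul n (\<lambda>X Y. of_bool (Y = swap_set a b X)) B X Y =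
      (\<Sum>Z\<in>Pow {1..n}. if Z = swap_set a b X then B Z Y else 0)"
    unfolding mmul_def by (intro sum.cong) auto
  then show ?thesis using swap_set_subset[OF assms] by simp
qed

lemma mmul_swap_right:
  assumes "a \<in> {1..n}" "b \<in> {1..n}" "Y \<subseteq> {1..n}"
  shows "mmul n B (\<lambda>X Y. of_bool (Y = swap_set a b X)) X Y = B X (swap_set a b Y)"
proof -
  have *: "Y = swap_set a b Z \<longleftrightarrow> Z = swap_set a b Y" for Z
    by (metis swap_set_swap_set)
  have "mmul n B (\<lambda>X Y. of_bool (Y = swap_set a b X)) X Y =
      (\<Sum>Z\<in>Pow {1..n}. if Z = swap_set a b Y then B X Z else 0)"
    unfolding mmul_def * by (intro sum.cong) auto
  then show ?thesis using swap_set_subset[OF assms] by simp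
qed

abbreviation Emat :: "nat \<Rightarrow> nat \<Rightarrow> nat set \<Rightarrow> nat set \<Rightarrow> nat" where
  "Emat a b \<equiv> \<lambda>X Y. of_bool (cup_cap a b X Y)"

abbreviation vmat :: "nat \<Rightarrow> nat \<Rightarrow> nat set \<Rightarrow> nat set \<Rightarrow> nat" where
  "vmat a b \<equiv> \<lambda>X Y. of_bool (Y = swap_set a b X)"

text \<open>The factor 2 is the closed curve through \<open>a\<close> and \<open>b\<close>: an
  intermediate colouring agrees with \<open>X\<close> elsewhere and is constant on these two points,
  with either colour.\<close>

lemma Emat_square:
  assumes "a \<in> {1..n}" "b \<in> {1..n}" "a \<noteq> b" "X \<subseteq> {1..n}" "Y \<subseteq> {1..n}"
  shows "mmul n (Emat a b) (Emat a b) X Y = 2 * Emat a b X Y"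
proof -
  have "{Z \<in> Pow {1..n}. cup_cap a b X Z \<and> cup_cap a b Z Y} =
      (if cup_cap a b X Y then {X - {a, b}, X \<union> {a, b}} else {})"
  proof (cases "cup_cap a b X Y")
    case True
    have "Z = X - {a, b} \<or> Z = X \<union> {a, b}" if "cup_cap a b X Z" for Z
      using that unfolding cup_cap_def set_eq_iff by (cases "a \<in> Z") (simp, metis)+
    moreover have "cup_cap a b X (X - {a, b})" "cup_cap a b X (X \<union> {a, b})"
      "cup_cap a b (X - {a, b}) Y" "cup_cap a b (X \<union> {a, b}) Y"
      using True by (auto simp: cup_cap_def)
    moreover have "X - {a, b} \<subseteq> {1..n}" "X \<union> {a, b} \<subseteq> {1..n}" using assms by auto
    ultimately show ?thesis using True by auto
  next
    case False
    then have "\<not> (cup_cap a b X Z \<and> cup_cap a b Z Y)" for Z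
      by (auto simp: cup_cap_def)
    then show ?thesis using False by auto
  qed
  moreover have "X - {a, b} \<noteq> X \<union> {a, b}" by auto
  ultimately show ?thesis by (simp add: mmul_of_bool)
qed

text \<open>The closed form is symmetric under exchanging the two pairs, which is what yields
  commutation later.\<close>

lemma Emat_far:
  assumes "distinct [a, b, c, d]" "X \<subseteq> {1..n}" "Y \<subseteq> {1..n}"
  shows "mmul n (Emat a b) (Emat c d) X Y = of_bool
    ((a \<in> X \<longleftrightarrow> b \<in> X) \<and> (a \<in> Y \<longleftrightarrow> b \<in> Y) \<and> (c \<in> X \<longleftrightarrow> d \<in> X) \<and> (c \<in> Y \<longleftrightarrow> d \<in> Y) \<and>
      (\<forall>k. k \<notin> {a, b, c, d} \<longrightarrow> (k \<in> X \<longleftrightarrow> k \<in> Y)))"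
\<comment> \<open>The second factor passes the colours at \<open>a\<close> and \<open>b\<close>
  through from \<open>Y\<close>; the first factor passes all others through from
  \<open>X\<close>.\<close>
proof (rule mmul_of_bool_unique[where W = "{k. if k = a \<or> k = b then k \<in> Y else k \<in> X}"], goal_cases)
  case (1 Z)
  have "a \<noteq> b" "a \<noteq> c" "a \<noteq> d" "b \<noteq> c" "b \<noteq> d" "c \<noteq> d" using assms(1) by auto
  then show ?case
    unfolding cup_cap_def set_eq_iff mem_Collect_eq insert_iff empty_iff by (smt (verit))
qed (use assms in auto)

lemma Emat_near:
  assumes "distinct [a, m, b]" "X \<subseteq> {1..n}" "Y \<subseteq> {1..n}" "{a, m, b} \<subseteq> {1..n}"
  shows "mmul n (Emat a m) (Emat m b) X Y = of_bool
    ((a \<in> X \<longleftrightarrow> m \<in> X) \<and> (m \<in> Y \<longleftrightarrow> b \<in> Y) \<and> (a \<in> Y \<longleftrightarrow> b \<in> X) \<and>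
      (\<forall>k. k \<notin> {a, m, b} \<longrightarrow> (k \<in> X \<longleftrightarrow> k \<in> Y)))"
\<comment> \<open>The arcs chain \<open>a\<close>, \<open>m\<close> and \<open>b\<close> together on
  the glued level, and \<open>a\<close> is passed through by the second factor, so all three take
  the colour of \<open>a\<close> in \<open>Y\<close>.\<close>
proof (rule mmul_of_bool_unique[where W = "{k. if k \<in> {a, m, b} then a \<in> Y else k \<in> X}"], goal_cases)
  case (1 Z)
  have "a \<noteq> m" "m \<noteq> b" "a \<noteq> b" using assms(1) by auto
  then show ?case
    unfolding cup_cap_def set_eq_iff mem_Collect_eq insert_iff empty_iff by (smt (verit))
qed (use assms in \<open>auto split: if_splits\<close>)

lemma mmul_cong:
  assumes "\<And>Z. Z \<subseteq> {1..n} \<Longrightarrow> A X Z = A' X Z" "\<And>Z. Z \<subseteq> {1..n} \<Longrightarrow> B Z Y = B' Z Y"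
  shows "mmul n A B X Y = mmul n A' B' X Y"
  unfolding mmul_def by (rule sum.cong) (use assms in auto)

text \<open>The zigzag through \<open>a\<close>, \<open>m\<close>, \<open>b\<close> straightens to a
  single arc and no closed curve is produced, hence no factor 2.\<close>

lemma Emat_near_triple:
  assumes d: "distinct [a, m, b]" and X: "X \<subseteq> {1..n}" and Y: "Y \<subseteq> {1..n}" and N: "{a, m, b} \<subseteq> {1..n}"
  shows "mmul n (mmul n (Emat a m) (Emat m b)) (Emat a m) X Y = Emat a m X Y"
proof -
  have "mmul n (mmul n (Emat a m) (Emat m b)) (Emat a m) X Y =
     mmul n (\<lambda>X Y. of_bool
    ((a \<in> X \<longleftrightarrow> m \<in> X) \<and> (m \<in> Y \<longleftrightarrow> b \<in> Y) \<and> (a \<in> Y \<longleftrightarrow> b \<in> X) \<and>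
      (\<forall>k. k \<notin> {a, m, b} \<longrightarrow> (k \<in> X \<longleftrightarrow> k \<in> Y)))) (Emat a m) X Y"
    by (rule mmul_cong) (use Emat_near[OF d X _ N] in auto)
  also have "\<dots> = Emat a m X Y"
  \<comment> \<open>The three points are again joined on the glued level; this time their colour
    comes from \<open>b\<close> in \<open>X\<close>, the point at which the zigzag begins.\<close>
  proof (rule mmul_of_bool_unique[where W = "{k. if k \<in> {a, m, b} then b \<in> X else k \<in> X}"], goal_cases)
    case (1 Z)
    have "a \<noteq> m" "m \<noteq> b" "a \<noteq> b" using d by auto
    then show ?case
      unfolding cup_cap_def set_eq_iff mem_Collect_eq insert_iff empty_iff by (smt (verit))
  qed (use X N in \<open>auto split: if_splits\<close>)
  finally show ?thesis .
qed

lemma vmat_square: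
  assumes "a \<in> {1..n}" "b \<in> {1..n}" "X \<subseteq> {1..n}"
  shows "mmul n (vmat a b) (vmat a b) X Y = of_bool (X = Y)"
  using assms by (auto simp: mmul_swap_left)

lemma vmat_far:
  assumes "distinct [a, b, c, d]" "{a, b, c, d} \<subseteq> {1..n}" "X \<subseteq> {1..n}"
  shows "mmul n (vmat a b) (vmat c d) X Y = mmul n (vmat c d) (vmat a b) X Y"
proof -
  have "swap_set a b (swap_set c d X) = swap_set c d (swap_set a b X)"
    using assms(1) by (auto simp: set_eq_iff mem_swap_set)
  then show ?thesis using assms by (simp add: mmul_swap_left)
qed

lemma vmat_Emat_far:
  assumes "distinct [a, b, c, d]" "{a, b, c, d} \<subseteq> {1..n}" "X \<subseteq> {1..n}" "Y \<subseteq> {1..n}"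
  shows "mmul n (vmat a b) (Emat c d) X Y = mmul n (Emat c d) (vmat a b) X Y"
proof -
  have "cup_cap c d (swap_set a b X) Y = cup_cap c d X (swap_set a b Y)"
  proof -
    have "a \<noteq> b" "a \<noteq> c" "a \<noteq> d" "b \<noteq> c" "b \<noteq> d" "c \<noteq> d" using assms(1) by auto
    then show ?thesis unfolding cup_cap_def mem_swap_set by (smt (verit))
  qed
  then show ?thesis using assms by (simp add: mmul_swap_left mmul_swap_right)
qed

lemma vmat_braid:
  assumes "distinct [a, m, b]" "{a, m, b} \<subseteq> {1..n}" "X \<subseteq> {1..n}"
  shows "mmul n (mmul n (vmat a m) (vmat m b)) (vmat a m) X Y =
    mmul n (mmul n (vmat m b) (vmat a m)) (vmat m b) X Y"
proof -
  have "swap_set a m (swap_set m b (swap_set a m X)) = swap_set m b (swap_set a m (swap_set m b X))"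
    using assms(1) by (auto simp: set_eq_iff mem_swap_set)
  then show ?thesis using assms by (simp add: mmul_assoc mmul_swap_left swap_set_subset)
qed

text \<open>The two swaps compose to a 3-cycle carrying one adjacent pair to the other. Moving the
  swaps onto the arguments leaves one \<open>cup_cap\<close> condition on each side.\<close>

lemma vmat_Emat_near:
  assumes "distinct [a, m, b]" "{a, m, b} \<subseteq> {1..n}" "X \<subseteq> {1..n}" "Y \<subseteq> {1..n}"
  shows "mmul n (mmul n (vmat a m) (vmat m b)) (Emat a m) X Y =
    mmul n (mmul n (Emat m b) (vmat a m)) (vmat m b) X Y"
proof -
  have "cup_cap a m (swap_set m b (swap_set a m X)) Y = cup_cap m b X (swap_set a m (swap_set m b Y))"
  proof -
    have "a \<noteq> m" "m \<noteq> b" "a \<noteq> b" using assms(1) by auto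
    then show ?thesis unfolding cup_cap_def mem_swap_set by (smt (verit))
  qed
  then show ?thesis
    using assms by (simp add: mmul_assoc[of n "vmat a m"] mmul_swap_left mmul_swap_right swap_set_subset)
qed

section \<open>Algebras over a commutative ring given as a type\<close>

locale scalar_algebra = ring N
  for N :: "('r::comm_ring_1, 'a, 'm) module_scheme" (structure) +
  assumes smult_closed [simp, intro]: "x \<in> carrier N \<Longrightarrow> r \<odot> x \<in> carrier N"
    and smult_l_distr: "x \<in> carrier N \<Longrightarrow> (r + s) \<odot> x = r \<odot> x \<oplus> s \<odot> x"
    and smult_r_distr: "x \<in> carrier N \<Longrightarrow> y \<in> carrier N \<Longrightarrow> r \<odot> (x \<oplus> y) = r \<odot> x \<oplus> r \<odot> y"
    and smult_assoc1: "x \<in> carrier N \<Longrightarrow> (r * s) \<odot> x = r \<odot> (s \<odot> x)"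
    and smult_one [simp]: "x \<in> carrier N \<Longrightarrow> 1 \<odot> x = x"
    and smult_l_assoc: "x \<in> carrier N \<Longrightarrow> y \<in> carrier N \<Longrightarrow> (r \<odot> x) \<otimes> y = r \<odot> (x \<otimes> y)"
    and smult_r_assoc: "x \<in> carrier N \<Longrightarrow> y \<in> carrier N \<Longrightarrow> x \<otimes> (r \<odot> y) = r \<odot> (x \<otimes> y)"
begin

lemma smult_zero_left [simp]: "x \<in> carrier N \<Longrightarrow> 0 \<odot> x = \<zero>"
  using smult_l_distr[of x 0 0] by (simp add: local.add.l_cancel_one)

lemma smult_zero_right [simp]: "r \<odot> \<zero> = \<zero>"
  using smult_r_distr[of \<zero> \<zero> r] by (simp add: local.add.l_cancel_one)

lemma smult_minus_left: "x \<in> carrier N \<Longrightarrow> (- r) \<odot> x = \<ominus> (r \<odot> x)"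
  using smult_l_distr[of x "- r" r] by (intro minus_equality[symmetric]) auto

end

section \<open>Finitely supported functions\<close>

lemma poly_mapping_eq_sum_single:
  "f = (\<Sum>k\<in>Poly_Mapping.keys f. Poly_Mapping.single k (Poly_Mapping.lookup f k))"
  by (rule poly_mapping_eqI) (simp add: lookup_sum lookup_single when_def in_keys_iff)

text \<open>Additive statements need checking on single terms only. This reduces every bilinear
  identity below to basis elements while keeping the supports inside \<open>B\<close>.\<close>

lemma keys_subset_induct [consumes 1, case_names zero single add]:
  assumes "Poly_Mapping.keys f \<subseteq> B" and "P 0"
    and "\<And>x a. x \<in> B \<Longrightarrow> P (Poly_Mapping.single x a)"
    and add: "\<And>f g. Poly_Mapping.keys f \<subseteq> B \<Longrightarrow> Poly_Mapping.keys g \<subseteq> B \<Longrightarrow> P f \<Longrightarrow> P g \<Longrightarrow> P (f + g)"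
  shows "P (f :: 'b \<Rightarrow>\<^sub>0 'r::comm_monoid_add)"
proof -
  let ?s = "\<lambda>k. Poly_Mapping.single k (Poly_Mapping.lookup f k)"
  \<comment> \<open>The support bound is carried along because the addition rule demands it of both
    summands.\<close>
  have "Poly_Mapping.keys (sum ?s S) \<subseteq> B \<and> P (sum ?s S)" if "finite S" "S \<subseteq> B" for S
    using that
  proof (induction S rule: finite_induct)
    case (insert x S)
    have x: "Poly_Mapping.keys (?s x) \<subseteq> B" using insert.prems by auto
    have "Poly_Mapping.keys (?s x + sum ?s S) \<subseteq> B"
      using keys_add[of "?s x" "sum ?s S"] x insert by blast
    moreover have "P (?s x + sum ?s S)"
      by (rule add) (use insert x assms in auto)
    ultimately show ?case using insert by simp
  qed (use assms in simp)
  from this[OF finite_keys assms(1)] show ?thesis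
    using poly_mapping_eq_sum_single[of f] by simp
qed

lemma lookup_map_mult:
  "Poly_Mapping.lookup (Poly_Mapping.map ((*) r) f) k = r * Poly_Mapping.lookup (f :: 'b \<Rightarrow>\<^sub>0 'r::comm_ring_1) k"
  by (simp add: Poly_Mapping.map.rep_eq when_def)

lemma map_mult_single:
  "Poly_Mapping.map ((*) r) (Poly_Mapping.single x a) = Poly_Mapping.single x (r * a :: 'r::comm_ring_1)"
  by (rule poly_mapping_eqI) (simp add: lookup_map_mult lookup_single when_def)

lemma map_mult_add:
  "Poly_Mapping.map ((*) r) (f + g) =
    Poly_Mapping.map ((*) r) f + Poly_Mapping.map ((*) (r :: 'r::comm_ring_1)) g"
  by (rule poly_mapping_eqI) (simp add: lookup_map_mult lookup_add distrib_left)

lemma map_mult_zero: "Poly_Mapping.map ((*) (r :: 'r::comm_ring_1)) 0 = 0"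
  by (rule poly_mapping_eqI) (simp add: lookup_map_mult)

lemma keys_map_mult: "Poly_Mapping.keys (Poly_Mapping.map ((*) (r :: 'r::comm_ring_1)) f) \<subseteq> Poly_Mapping.keys f"
  by (auto simp: in_keys_iff lookup_map_mult)

subsection \<open>Algebras with a basis\<close>

lemma basis_algebra_simps [simp]:
  "carrier (basis_algebra B p c e) = {f. Poly_Mapping.keys f \<subseteq> B}"
  "one (basis_algebra B p c e) = Poly_Mapping.single e 1"
  "zero (basis_algebra B p c e) = 0"
  "add (basis_algebra B p c e) = (+)"
  "smult (basis_algebra B p c e) = (\<lambda>r. Poly_Mapping.map ((*) r))"
  by (simp_all add: basis_algebra_def)

text \<open>Enlarging the index sets beyond the supports adds only zero terms; products of functions
  with different supports can then be added over common index sets.\<close>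

lemma basis_mult_sum:
  assumes "finite S" "Poly_Mapping.keys f \<subseteq> S" "finite T" "Poly_Mapping.keys g \<subseteq> T"
  shows "f \<otimes>\<^bsub>basis_algebra B p c e\<^esub> g = (\<Sum>x\<in>S. \<Sum>y\<in>T.
    Poly_Mapping.single (p x y) (Poly_Mapping.lookup f x * Poly_Mapping.lookup g y * c x y))"
proof -
  have "f \<otimes>\<^bsub>basis_algebra B p c e\<^esub> g = (\<Sum>x\<in>Poly_Mapping.keys f. \<Sum>y\<in>Poly_Mapping.keys g.
    Poly_Mapping.single (p x y) (Poly_Mapping.lookup f x * Poly_Mapping.lookup g y * c x y))"
    by (simp add: basis_algebra_def)
  also have "\<dots> = (\<Sum>x\<in>Poly_Mapping.keys f. \<Sum>y\<in>T.
    Poly_Mapping.single (p x y) (Poly_Mapping.lookup f x * Poly_Mapping.lookup g y * c x y))"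
    by (intro sum.cong refl sum.mono_neutral_left) (use assms in \<open>auto simp: in_keys_iff\<close>)
  also have "\<dots> = (\<Sum>x\<in>S. \<Sum>y\<in>T.
    Poly_Mapping.single (p x y) (Poly_Mapping.lookup f x * Poly_Mapping.lookup g y * c x y))"
    by (intro sum.mono_neutral_left) (use assms in \<open>auto simp: in_keys_iff\<close>)
  finally show ?thesis .
qed

lemma basis_mult_single [simp]:
  "Poly_Mapping.single x a \<otimes>\<^bsub>basis_algebra B p c e\<^esub> Poly_Mapping.single y b =
    Poly_Mapping.single (p x y) (a * b * c x y)"
  by (subst basis_mult_sum[where S = "{x}" and T = "{y}"]) auto

lemma basis_mult_add_left:
  "(f + f') \<otimes>\<^bsub>basis_algebra B p c e\<^esub> g =
    f \<otimes>\<^bsub>basis_algebra B p c e\<^esub> g + f' \<otimes>\<^bsub>basis_algebra B p c e\<^esub> g"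
proof -
  let ?S = "Poly_Mapping.keys f \<union> Poly_Mapping.keys f'" and ?T = "Poly_Mapping.keys g"
  show ?thesis
    using keys_add[of f f']
    by (simp add: basis_mult_sum[of ?S _ ?T] lookup_add distrib_right single_add sum.distrib)
qed

lemma basis_mult_add_right:
  "f \<otimes>\<^bsub>basis_algebra B p c e\<^esub> (g + g') =
    f \<otimes>\<^bsub>basis_algebra B p c e\<^esub> g + f \<otimes>\<^bsub>basis_algebra B p c e\<^esub> g'"
proof -
  let ?S = "Poly_Mapping.keys f" and ?T = "Poly_Mapping.keys g \<union> Poly_Mapping.keys g'"
  show ?thesis
    using keys_add[of g g']
    by (simp add: basis_mult_sum[of ?S _ ?T] lookup_add distrib_left distrib_right single_add sum.distrib)
qed

lemma basis_mult_zero [simp]: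
  "0 \<otimes>\<^bsub>basis_algebra B p c e\<^esub> g = 0" "f \<otimes>\<^bsub>basis_algebra B p c e\<^esub> 0 = 0"
  by (simp_all add: basis_algebra_def)

lemma basis_mult_diff_left:
  "(f - f') \<otimes>\<^bsub>basis_algebra B p c e\<^esub> g =
    f \<otimes>\<^bsub>basis_algebra B p c e\<^esub> g - f' \<otimes>\<^bsub>basis_algebra B p c e\<^esub> g"
  using basis_mult_add_left[where f = "f - f'" and f' = f'] by (simp add: eq_diff_eq)

lemma basis_mult_diff_right:
  "f \<otimes>\<^bsub>basis_algebra B p c e\<^esub> (g - g') =
    f \<otimes>\<^bsub>basis_algebra B p c e\<^esub> g - f \<otimes>\<^bsub>basis_algebra B p c e\<^esub> g'"
  using basis_mult_add_right[where g = "g - g'" and g' = g'] by (simp add: eq_diff_eq)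

lemma basis_mult_smult_left:
  "Poly_Mapping.map ((*) r) f \<otimes>\<^bsub>basis_algebra B p c e\<^esub> g =
    Poly_Mapping.map ((*) r) (f \<otimes>\<^bsub>basis_algebra B p c e\<^esub> g)"
proof -
  have "Poly_Mapping.keys f \<subseteq> UNIV" and g: "Poly_Mapping.keys g \<subseteq> UNIV" by auto
  from this(1) show ?thesis
  proof (induction f rule: keys_subset_induct)
    case (single x a)
    from g show ?case
      by (induction g rule: keys_subset_induct)
        (simp_all add: basis_mult_add_right map_mult_add map_mult_zero map_mult_single mult.assoc)
  qed (simp_all add: basis_mult_add_left map_mult_add map_mult_zero)
qed

lemma basis_mult_smult_right:
  "f \<otimes>\<^bsub>basis_algebra B p c e\<^esub> Poly_Mapping.map ((*) r) g =
    Poly_Mapping.map ((*) r) (f \<otimes>\<^bsub>basis_algebra B p c e\<^esub> g)"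
proof -
  have "Poly_Mapping.keys f \<subseteq> UNIV" and g: "Poly_Mapping.keys g \<subseteq> UNIV" by auto
  from this(1) show ?thesis
  proof (induction f rule: keys_subset_induct)
    case (single x a)
    from g show ?case
      by (induction g rule: keys_subset_induct)
        (simp_all add: basis_mult_add_right map_mult_add map_mult_zero map_mult_single mult.left_commute mult.assoc)
  qed (simp_all add: basis_mult_add_left map_mult_add map_mult_zero)
qed

text \<open>\<open>c_assoc\<close> is a cocycle condition: together with \<open>p_assoc\<close> it
  is associativity on basis elements. For tangles it says that both bracketings of a triple product
  create equally many closed curves.\<close>

locale structure_constants =
  fixes B :: "'b set" and p :: "'b \<Rightarrow> 'b \<Rightarrow> 'b" and c :: "'b \<Rightarrow> 'b \<Rightarrow> 'r::comm_ring_1" and e :: 'b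
  assumes p_closed: "x \<in> B \<Longrightarrow> y \<in> B \<Longrightarrow> p x y \<in> B"
    and e_in: "e \<in> B"
    and p_assoc: "x \<in> B \<Longrightarrow> y \<in> B \<Longrightarrow> w \<in> B \<Longrightarrow> p (p x y) w = p x (p y w)"
    and c_assoc: "x \<in> B \<Longrightarrow> y \<in> B \<Longrightarrow> w \<in> B \<Longrightarrow> c x y * c (p x y) w = c y w * c x (p y w)"
    and p_unit: "x \<in> B \<Longrightarrow> p e x = x" "x \<in> B \<Longrightarrow> p x e = x"
    and c_unit: "x \<in> B \<Longrightarrow> c e x = 1" "x \<in> B \<Longrightarrow> c x e = 1"
begin

abbreviation A :: "('r, 'b \<Rightarrow>\<^sub>0 'r) module" where "A \<equiv> basis_algebra B p c e"

lemma basis_mult_closed: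
  assumes "Poly_Mapping.keys f \<subseteq> B" "Poly_Mapping.keys g \<subseteq> B"
  shows "Poly_Mapping.keys (f \<otimes>\<^bsub>A\<^esub> g) \<subseteq> B"
  using assms(1)
proof (induction f rule: keys_subset_induct)
  case (single x a)
  from assms(2) show ?case
  proof (induction g rule: keys_subset_induct)
    case (single y b)
    then show ?case using \<open>x \<in> B\<close> p_closed by simp
  next
    case (add g g')
    then show ?case unfolding basis_mult_add_right
      by (intro order_trans[OF keys_add]) simp
  qed simp
next
  case (add f f')
  then show ?case unfolding basis_mult_add_left
      by (intro order_trans[OF keys_add]) simp
qed simp

lemma basis_mult_assoc:
  assumes "Poly_Mapping.keys f \<subseteq> B" and g: "Poly_Mapping.keys g \<subseteq> B" and h: "Poly_Mapping.keys h \<subseteq> B"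
  shows "(f \<otimes>\<^bsub>A\<^esub> g) \<otimes>\<^bsub>A\<^esub> h = f \<otimes>\<^bsub>A\<^esub> (g \<otimes>\<^bsub>A\<^esub> h)"
  using assms(1)
proof (induction f rule: keys_subset_induct)
  case (single x a)
  note x = this
  from g show ?case
  proof (induction g rule: keys_subset_induct)
    case (single y b)
    note y = this
    from h show ?case
    proof (induction h rule: keys_subset_induct)
      case (single w d)
      have "a * b * c x y * d * c (p x y) w = a * (b * d) * (c x y * c (p x y) w)"
        by (simp add: mult_ac)
      also have "\<dots> = a * (b * d * c y w) * c x (p y w)"
        using c_assoc[OF x y single] by (simp add: mult_ac)
      finally show ?case using p_assoc[OF x y single] by simp
    qed (simp_all add: basis_mult_add_right)
  qed (simp_all add: basis_mult_add_left basis_mult_add_right)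
qed (simp_all add: basis_mult_add_left)

lemma basis_mult_one:
  assumes "Poly_Mapping.keys f \<subseteq> B"
  shows "Poly_Mapping.single e 1 \<otimes>\<^bsub>A\<^esub> f = f" and "f \<otimes>\<^bsub>A\<^esub> Poly_Mapping.single e 1 = f"
proof -
  show "Poly_Mapping.single e 1 \<otimes>\<^bsub>A\<^esub> f = f"
    using assms by (induction f rule: keys_subset_induct) (simp_all add: basis_mult_add_right p_unit c_unit)
  show "f \<otimes>\<^bsub>A\<^esub> Poly_Mapping.single e 1 = f"
    using assms by (induction f rule: keys_subset_induct) (simp_all add: basis_mult_add_left p_unit c_unit)
qed

lemma ring_basis_algebra: "ring A"
proof (rule ringI)
  show "abelian_group A"
  proof (rule abelian_groupI)
    fix f assume "f \<in> carrier A"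
    then show "\<exists>g\<in>carrier A. g \<oplus>\<^bsub>A\<^esub> f = \<zero>\<^bsub>A\<^esub>"
      by (intro bexI[of _ "- f"]) (auto simp: in_keys_iff)
  next
    fix f g assume "f \<in> carrier A" "g \<in> carrier A"
    then show "f \<oplus>\<^bsub>A\<^esub> g \<in> carrier A" using keys_add[of f g] by auto
  qed (simp_all add: add_ac)
  show "Group.monoid A"
    by (rule monoidI) (simp_all add: basis_mult_assoc basis_mult_one e_in basis_mult_closed)
qed (simp_all add: basis_mult_add_left basis_mult_add_right)

lemma scalar_algebra_basis_algebra: "scalar_algebra A"
proof (intro scalar_algebra.intro scalar_algebra_axioms.intro ring_basis_algebra)
  fix f :: "'b \<Rightarrow>\<^sub>0 'r" and r assume "f \<in> carrier A"
  then show "r \<odot>\<^bsub>A\<^esub> f \<in> carrier A" using keys_map_mult[of r f] by auto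
next
  fix f :: "'b \<Rightarrow>\<^sub>0 'r" and r s
  show "(r + s) \<odot>\<^bsub>A\<^esub> f = r \<odot>\<^bsub>A\<^esub> f \<oplus>\<^bsub>A\<^esub> s \<odot>\<^bsub>A\<^esub> f"
    by (auto intro!: poly_mapping_eqI simp: lookup_map_mult lookup_add distrib_right)
  show "(r * s) \<odot>\<^bsub>A\<^esub> f = r \<odot>\<^bsub>A\<^esub> (s \<odot>\<^bsub>A\<^esub> f)"
    by (auto intro!: poly_mapping_eqI simp: lookup_map_mult mult.assoc)
  show "1 \<odot>\<^bsub>A\<^esub> f = f"
    by (auto intro!: poly_mapping_eqI simp: lookup_map_mult)
qed (simp_all only: basis_algebra_simps basis_mult_smult_left basis_mult_smult_right map_mult_add)

lemma a_inv_basis_algebra: "f \<in> carrier A \<Longrightarrow> \<ominus>\<^bsub>A\<^esub> f = - f"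
proof -
  assume f: "f \<in> carrier A"
  interpret ring A by (rule ring_basis_algebra)
  show ?thesis
    by (rule minus_equality) (use f in \<open>auto simp: in_keys_iff\<close>)
qed

end

section \<open>Extension of scalars\<close>

locale scalar_extension = scalar_algebra M
  for M :: "('r::comm_ring_1, 'm, 'p) module_scheme" (structure) +
  fixes h :: "'r \<Rightarrow> 's::comm_ring_1"
begin

abbreviation P :: "(int, ('s \<times> 'm) \<Rightarrow>\<^sub>0 int) module" where "P \<equiv> pair_algebra M"

abbreviation K :: "(('s \<times> 'm) \<Rightarrow>\<^sub>0 int) set" where "K \<equiv> tensor_kernel h M"

abbreviation N :: "('s, (('s \<times> 'm) \<Rightarrow>\<^sub>0 int) set) module" where "N \<equiv> extend_scalars h M"

abbreviation pt :: "'s \<Rightarrow> 'm \<Rightarrow> (('s \<times> 'm) \<Rightarrow>\<^sub>0 int) set" where "pt \<equiv> pure_tensor h M"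

abbreviation d :: "'s \<Rightarrow> 'm \<Rightarrow> ('s \<times> 'm) \<Rightarrow>\<^sub>0 int" where "d s x \<equiv> Poly_Mapping.single (s, x) 1"

lemma structure_constants_pair:
  "structure_constants (UNIV \<times> carrier M) (\<lambda>(s, x) (t, y). (s * t, x \<otimes> y)) (\<lambda>_ _. 1 :: int) (1 :: 's, \<one>)"
  by unfold_locales (auto simp: m_assoc mult.assoc)

lemma ring_P: "ring P"
  unfolding pair_algebra_def by (rule structure_constants.ring_basis_algebra[OF structure_constants_pair])

lemma carrier_P: "carrier P = {f. Poly_Mapping.keys f \<subseteq> UNIV \<times> carrier M}"
  by (simp add: pair_algebra_def)

lemma P_simps [simp]: "add P = (+)" "zero P = 0" "one P = d 1 \<one>"
  by (simp_all add: pair_algebra_def)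

lemma a_inv_P: "f \<in> carrier P \<Longrightarrow> \<ominus>\<^bsub>P\<^esub> f = - f"
  unfolding pair_algebra_def by (rule structure_constants.a_inv_basis_algebra[OF structure_constants_pair])

lemma P_mult_d [simp]: "d s x \<otimes>\<^bsub>P\<^esub> d t y = d (s * t) (x \<otimes> y)"
  by (simp add: pair_algebra_def)

lemma P_mult_diff:
  "(f - f') \<otimes>\<^bsub>P\<^esub> g = f \<otimes>\<^bsub>P\<^esub> g - f' \<otimes>\<^bsub>P\<^esub> g" "f \<otimes>\<^bsub>P\<^esub> (g - g') = f \<otimes>\<^bsub>P\<^esub> g - f \<otimes>\<^bsub>P\<^esub> g'"
  unfolding pair_algebra_def by (rule basis_mult_diff_left basis_mult_diff_right)+

lemma P_mult_zero [simp]: "0 \<otimes>\<^bsub>P\<^esub> g = 0" "f \<otimes>\<^bsub>P\<^esub> 0 = 0"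
  by (simp_all add: pair_algebra_def)

lemma d_in [simp]: "x \<in> carrier M \<Longrightarrow> d s x \<in> carrier P"
  by (simp add: carrier_P)

lemma diff_in: "f \<in> carrier P \<Longrightarrow> g \<in> carrier P \<Longrightarrow> f - g \<in> carrier P"
  unfolding carrier_P mem_Collect_eq by (rule order_trans[OF keys_diff]) simp

lemma tensor_rels_eq: "tensor_rels h M =
    {d (s + t) x - d s x - d t x | s t x. x \<in> carrier M}
  \<union> {d s (x \<oplus> y) - d s x - d s y | s x y. x \<in> carrier M \<and> y \<in> carrier M}
  \<union> {d (s * h r) x - d s (r \<odot> x) | s r x. x \<in> carrier M}"
  by (simp add: tensor_rels_def Let_def)

lemma tensor_rels_cases:
  assumes "q \<in> tensor_rels h M"
  obtains (left) s t x where "x \<in> carrier M" "q = d (s + t) x - d s x - d t x"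
  | (right) s x y where "x \<in> carrier M" "y \<in> carrier M" "q = d s (x \<oplus> y) - d s x - d s y"
  | (balance) s r x where "x \<in> carrier M" "q = d (s * h r) x - d s (r \<odot> x)"
  using assms unfolding tensor_rels_eq
  by (elim UnE CollectE exE conjE)
    ((rule left; assumption) | (rule right; assumption) | (rule balance; assumption))+

lemma tensor_relsI:
  assumes "x \<in> carrier M"
  shows "d (s + t) x - d s x - d t x \<in> tensor_rels h M"
    and "y \<in> carrier M \<Longrightarrow> d s (x \<oplus> y) - d s x - d s y \<in> tensor_rels h M"
    and "d (s * h r) x - d s (r \<odot> x) \<in> tensor_rels h M"
proof -
  show "d (s + t) x - d s x - d t x \<in> tensor_rels h M"
    unfolding tensor_rels_eq
    by (intro UnI1 CollectI exI[of _ s] exI[of _ t] exI[of _ x]) (simp add: assms)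
  show "d s (x \<oplus> y) - d s x - d s y \<in> tensor_rels h M" if "y \<in> carrier M"
    unfolding tensor_rels_eq
    by (rule UnI1, intro UnI2 CollectI exI[of _ s] exI[of _ x] exI[of _ y]) (simp add: assms that)
  show "d (s * h r) x - d s (r \<odot> x) \<in> tensor_rels h M"
    unfolding tensor_rels_eq
    by (intro UnI2 CollectI exI[of _ s] exI[of _ r] exI[of _ x]) (simp add: assms)
qed

lemma tensor_rels_subset: "tensor_rels h M \<subseteq> carrier P"
proof
  fix q assume "q \<in> tensor_rels h M"
  then show "q \<in> carrier P" by (cases rule: tensor_rels_cases) (auto intro!: diff_in)
qed

text \<open>Multiplication by a pure pair sends each relation to a relation of the same kind. The
  balancing relations use that scalars commute and can be pulled out of either factor of a product
  in \<open>M\<close>.\<close>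

lemma tensor_rels_mult:
  assumes "q \<in> tensor_rels h M" and y: "y \<in> carrier M"
  shows "d t y \<otimes>\<^bsub>P\<^esub> q \<in> tensor_rels h M" and "q \<otimes>\<^bsub>P\<^esub> d t y \<in> tensor_rels h M"
proof -
  from assms(1) have "d t y \<otimes>\<^bsub>P\<^esub> q \<in> tensor_rels h M \<and> q \<otimes>\<^bsub>P\<^esub> d t y \<in> tensor_rels h M"
  proof (cases rule: tensor_rels_cases)
    case (left s s' x)
    then show ?thesis
      using y tensor_relsI(1)[of "y \<otimes> x" "t * s" "t * s'"] tensor_relsI(1)[of "x \<otimes> y" "s * t" "s' * t"]
      by (simp add: P_mult_diff distrib_left distrib_right)
  next
    case (right s x x')
    then show ?thesis
      using y tensor_relsI(2)[of "y \<otimes> x" "y \<otimes> x'" "t * s"] tensor_relsI(2)[of "x \<otimes> y" "x' \<otimes> y" "s * t"]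
      by (simp add: P_mult_diff l_distr r_distr)
  next
    case (balance s r x)
    then show ?thesis
      using y tensor_relsI(3)[of "y \<otimes> x" "t * s" r] tensor_relsI(3)[of "x \<otimes> y" "s * t" r]
      by (simp add: P_mult_diff smult_l_assoc smult_r_assoc mult_ac)
  qed
  then show "d t y \<otimes>\<^bsub>P\<^esub> q \<in> tensor_rels h M" "q \<otimes>\<^bsub>P\<^esub> d t y \<in> tensor_rels h M" by auto
qed

lemma subgroup_K: "subgroup K (add_monoid P)"
proof -
  interpret P: ring P by (rule ring_P)
  show ?thesis
    unfolding tensor_kernel_def
    by (rule P.add.generate_is_subgroup) (use tensor_rels_subset in simp)
qed

lemma K_subset: "K \<subseteq> carrier P"
  using subgroup.subset[OF subgroup_K] by simp

lemma K_zero: "0 \<in> K"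
  using subgroup.one_closed[OF subgroup_K] by simp

lemma K_add: "f \<in> K \<Longrightarrow> g \<in> K \<Longrightarrow> f + g \<in> K"
  using subgroup.m_closed[OF subgroup_K] by simp

lemma K_uminus: "f \<in> K \<Longrightarrow> - f \<in> K"
  using subgroup.m_inv_closed[OF subgroup_K, of f] a_inv_P[of f] K_subset by (auto simp: a_inv_def)

lemma K_diff: "f \<in> K \<Longrightarrow> g \<in> K \<Longrightarrow> f - g \<in> K"
  using K_add[of f "- g"] K_uminus by simp

lemma rels_in_K: "q \<in> tensor_rels h M \<Longrightarrow> q \<in> K"
  unfolding tensor_kernel_def by (rule generate.incl)

text \<open>The kernel is generated as an additive group only; absorption of products holds since
  the generating set is itself stable under multiplication by pure pairs.\<close>

lemma ideal_K: "ideal K P"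
proof (rule idealI[OF ring_P subgroup_K])
  interpret P: ring P by (rule ring_P)
  have rel: "f \<otimes>\<^bsub>P\<^esub> q \<in> K \<and> q \<otimes>\<^bsub>P\<^esub> f \<in> K" if q: "q \<in> tensor_rels h M" and f: "f \<in> carrier P" for q f
  proof -
    have "Poly_Mapping.keys f \<subseteq> UNIV \<times> carrier M" using f by (simp add: carrier_P)
    then show ?thesis
    \<comment> \<open>The coefficients are integers, so every element arises from pure pairs by
      repeated differences, and \<open>K\<close> is closed under differences.\<close>
    proof (induction f rule: frag_induction)
      case (one x)
      then show ?case using tensor_rels_mult[OF q] rels_in_K by (cases x) auto
    qed (auto simp: P_mult_diff K_zero K_diff)
  qed
  have "f \<otimes>\<^bsub>P\<^esub> a \<in> K \<and> a \<otimes>\<^bsub>P\<^esub> f \<in> K" if a: "a \<in> K" and f: "f \<in> carrier P" for a f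
  proof -
    have "a \<in> generate (add_monoid P) (tensor_rels h M)"
      using a by (simp only: tensor_kernel_def)
    then show ?thesis
    proof (induction a rule: generate.induct)
      case one
      then show ?case using K_zero by simp
    next
      case (incl q)
      then show ?case using rel f by simp
    next
      case (inv q)
      then have q: "q \<in> carrier P" using tensor_rels_subset by auto
      have "inv\<^bsub>add_monoid P\<^esub> q = \<ominus>\<^bsub>P\<^esub> q" by (simp add: a_inv_def)
      \<comment> \<open>Writing the inverse as a difference from 0 makes the distributive law for
        differences applicable.\<close>
      then have "inv\<^bsub>add_monoid P\<^esub> q = 0 - q" using a_inv_P[OF q] by simp
      moreover have "f \<otimes>\<^bsub>P\<^esub> (0 - q) = - (f \<otimes>\<^bsub>P\<^esub> q)" "(0 - q) \<otimes>\<^bsub>P\<^esub> f = - (q \<otimes>\<^bsub>P\<^esub> f)"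
        unfolding P_mult_diff by simp_all
      ultimately show ?case using rel[OF inv f] K_uminus by (simp only:)
    next
      case (eng a b)
      then have "a \<in> K" "b \<in> K" by (simp_all only: tensor_kernel_def)
      then have ab: "a \<in> carrier P" "b \<in> carrier P" using K_subset by auto
      then show ?case
        using eng.IH P.l_distr[OF ab f] P.r_distr[OF ab f] by (auto simp: K_add)
    qed
  qed
  then show "f \<otimes>\<^bsub>P\<^esub> a \<in> K" "a \<otimes>\<^bsub>P\<^esub> f \<in> K" if "a \<in> K" "f \<in> carrier P" for a f
    using that by auto
qed

lemma N_simps:
  "carrier N = carrier (P Quot K)" "mult N = mult (P Quot K)" "one N = one (P Quot K)"
  "zero N = zero (P Quot K)" "add N = add (P Quot K)" "smult N = (\<lambda>s X. pt s \<one> \<otimes>\<^bsub>P Quot K\<^esub> X)"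
  by (simp_all add: extend_scalars_def Let_def)

lemma ring_N: "ring N"
proof -
  interpret Q: ring "P Quot K" by (rule ideal.quotient_is_ring[OF ideal_K])
  show ?thesis
  proof (rule ringI)
    show "abelian_group N"
    proof (rule abelian_groupI)
      fix x assume "x \<in> carrier N"
      then show "\<exists>y\<in>carrier N. y \<oplus>\<^bsub>N\<^esub> x = \<zero>\<^bsub>N\<^esub>"
        by (intro bexI[of _ "\<ominus>\<^bsub>P Quot K\<^esub> x"]) (simp_all add: N_simps Q.l_neg)
    qed (simp_all add: N_simps Q.a_ac)
    show "Group.monoid N"
      by (rule monoidI) (simp_all add: N_simps Q.m_assoc)
  qed (simp_all add: N_simps Q.l_distr Q.r_distr)
qed

lemma coset_hom: "(\<lambda>f. K +>\<^bsub>P\<^esub> f) \<in> ring_hom P N"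
  using ideal.rcos_ring_hom[OF ideal_K] by (simp add: ring_hom_def N_simps)

lemma coset_eq:
  assumes "f \<in> carrier P" "g \<in> carrier P" "f - g \<in> K"
  shows "K +>\<^bsub>P\<^esub> f = K +>\<^bsub>P\<^esub> g"
  using ring.quotient_eq_iff_same_a_r_cos[OF ring_P ideal_K assms(1,2)] assms a_inv_P[OF assms(2)]
  by (simp add: a_minus_def)

lemma N_cases:
  assumes "X \<in> carrier N"
  obtains f where "f \<in> carrier P" "X = K +>\<^bsub>P\<^esub> f"
  using assms by (auto simp: N_simps FactRing_def A_RCOSETS_def RCOSETS_def a_r_coset_def r_coset_def)

lemma pt_eq: "pt s x = K +>\<^bsub>P\<^esub> d s x"
  by (simp add: pure_tensor_def)

lemma pt_closed [simp]: "x \<in> carrier M \<Longrightarrow> pt s x \<in> carrier N"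
  unfolding pt_eq by (rule ring_hom_closed[OF coset_hom]) simp

lemma pt_mult:
  "x \<in> carrier M \<Longrightarrow> y \<in> carrier M \<Longrightarrow> pt s x \<otimes>\<^bsub>N\<^esub> pt t y = pt (s * t) (x \<otimes> y)"
  unfolding pt_eq by (simp flip: ring_hom_mult[OF coset_hom])

lemma pt_one: "pt 1 \<one> = \<one>\<^bsub>N\<^esub>"
  unfolding pt_eq using ring_hom_one[OF coset_hom] by simp

lemma pt_add_left:
  assumes "x \<in> carrier M"
  shows "pt (s + t) x = pt s x \<oplus>\<^bsub>N\<^esub> pt t x"
proof -
  interpret P: ring P by (rule ring_P)
  have "pt s x \<oplus>\<^bsub>N\<^esub> pt t x = K +>\<^bsub>P\<^esub> (d s x + d t x)"
    unfolding pt_eq using assms ring_hom_add[OF coset_hom, of "d s x" "d t x"] by simp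
  moreover have "K +>\<^bsub>P\<^esub> d (s + t) x = K +>\<^bsub>P\<^esub> (d s x + d t x)"
    by (rule coset_eq)
      (use assms P.a_closed[of "d s x" "d t x"] rels_in_K[OF tensor_relsI(1)[of x s t]] in
        \<open>simp_all add: diff_diff_eq\<close>)
  ultimately show ?thesis by (simp add: pt_eq)
qed

lemma pt_balance: "x \<in> carrier M \<Longrightarrow> pt (s * h r) x = pt s (r \<odot> x)"
  unfolding pt_eq by (rule coset_eq) (simp_all add: rels_in_K tensor_relsI)

lemma smult_N: "s \<odot>\<^bsub>N\<^esub> X = pt s \<one> \<otimes>\<^bsub>N\<^esub> X"
  by (simp add: N_simps)

lemma smult_pt: "x \<in> carrier M \<Longrightarrow> s \<odot>\<^bsub>N\<^esub> pt t x = pt (s * t) x"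
  by (simp add: smult_N pt_mult)

text \<open>Scalars act by left multiplication with \<open>pt s \<one>\<close>, so pulling a scalar
  out of the right factor of a product requires this element to be central. The commutation holds
  already for representatives, before passing to the quotient.\<close>

lemma pt_central:
  assumes "X \<in> carrier N"
  shows "pt s \<one> \<otimes>\<^bsub>N\<^esub> X = X \<otimes>\<^bsub>N\<^esub> pt s \<one>"
proof -
  obtain f where f: "f \<in> carrier P" "X = K +>\<^bsub>P\<^esub> f" using N_cases[OF assms] .
  have "Poly_Mapping.keys f \<subseteq> UNIV \<times> carrier M" using f by (simp add: carrier_P)
  then have "d s \<one> \<otimes>\<^bsub>P\<^esub> f = f \<otimes>\<^bsub>P\<^esub> d s \<one>"
    by (induction f rule: frag_induction) (auto simp: P_mult_diff mult.commute)
  then show ?thesis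
    unfolding pt_eq f(2) using f(1) by (simp flip: ring_hom_mult[OF coset_hom])
qed

lemma scalar_algebra_N: "scalar_algebra N"
proof -
  interpret N: ring N by (rule ring_N)
  show ?thesis
  proof unfold_locales
    fix X Y and r s :: 's assume X: "X \<in> carrier N"
    show "r \<odot>\<^bsub>N\<^esub> X \<in> carrier N" using X by (simp add: smult_N)
    show "(r + s) \<odot>\<^bsub>N\<^esub> X = r \<odot>\<^bsub>N\<^esub> X \<oplus>\<^bsub>N\<^esub> s \<odot>\<^bsub>N\<^esub> X"
      using X by (simp add: smult_N pt_add_left N.l_distr)
    show "(r * s) \<odot>\<^bsub>N\<^esub> X = r \<odot>\<^bsub>N\<^esub> (s \<odot>\<^bsub>N\<^esub> X)"
      using X by (simp add: smult_N pt_mult flip: N.m_assoc)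
    show "1 \<odot>\<^bsub>N\<^esub> X = X" using X by (simp add: smult_N pt_one)
    assume Y: "Y \<in> carrier N"
    show "r \<odot>\<^bsub>N\<^esub> (X \<oplus>\<^bsub>N\<^esub> Y) = r \<odot>\<^bsub>N\<^esub> X \<oplus>\<^bsub>N\<^esub> r \<odot>\<^bsub>N\<^esub> Y"
      using X Y by (simp add: smult_N N.r_distr)
    show "(r \<odot>\<^bsub>N\<^esub> X) \<otimes>\<^bsub>N\<^esub> Y = r \<odot>\<^bsub>N\<^esub> (X \<otimes>\<^bsub>N\<^esub> Y)"
      using X Y by (simp add: smult_N N.m_assoc)
    show "X \<otimes>\<^bsub>N\<^esub> (r \<odot>\<^bsub>N\<^esub> Y) = r \<odot>\<^bsub>N\<^esub> (X \<otimes>\<^bsub>N\<^esub> Y)"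
      using X Y pt_central[of X r] by (simp add: smult_N flip: N.m_assoc)
  qed
qed

end

section \<open>The universal property of a presented group\<close>

text \<open>The inverse letters get their own assignment \<open>w\<close>, since the target is a
  monoid in which inverses must be supplied.\<close>

definition word_eval :: "('h, 'm) monoid_scheme \<Rightarrow> ('g \<Rightarrow> 'h) \<Rightarrow> ('g \<Rightarrow> 'h) \<Rightarrow> 'g word \<Rightarrow> 'h" where
  "word_eval H u w ws = foldr (\<lambda>(b, x) a. (if b then u x else w x) \<otimes>\<^bsub>H\<^esub> a) ws \<one>\<^bsub>H\<^esub>"

lemma word_eval_simps [simp]:
  "word_eval H u w [] = \<one>\<^bsub>H\<^esub>"
  "word_eval H u w ((b, x) # ws) = (if b then u x else w x) \<otimes>\<^bsub>H\<^esub> word_eval H u w ws"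
  by (simp_all add: word_eval_def)

lemma pres_cong_words:
  "(v, w) \<in> pres_cong X rels \<Longrightarrow> v \<in> lists (UNIV \<times> X) \<and> w \<in> lists (UNIV \<times> X)"
  by (induction rule: pres_cong.induct) auto

lemma pres_cong_append:
  assumes "(u, u') \<in> pres_cong X rels" "(w, w') \<in> pres_cong X rels"
  shows "(u @ w, u' @ w') \<in> pres_cong X rels"
proof -
  have "(u @ w, u' @ w) \<in> pres_cong X rels"
    using pres_cong.cong[OF assms(1), of "[]" w] pres_cong_words[OF assms(2)] by simp
  moreover have "(u' @ w, u' @ w') \<in> pres_cong X rels"
    using pres_cong.cong[OF assms(2), of u' "[]"] pres_cong_words[OF assms(1)] by simp
  ultimately show ?thesis by (rule pres_cong.trans)
qed

lemma equiv_pres_cong: "equiv (lists (UNIV \<times> X)) (pres_cong X rels)"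
proof (rule equivI)
  show "refl_on (lists (UNIV \<times> X)) (pres_cong X rels)"
    by (auto simp: refl_on_def intro: pres_cong.refl)
  show "sym (pres_cong X rels)" by (auto simp: sym_def intro: pres_cong.sym)
  show "trans (pres_cong X rels)" by (auto simp: trans_def intro: pres_cong.trans)
qed (auto dest: pres_cong_words)

text \<open>The congruence is compatible with concatenation, so the double union in the definition
  runs over copies of a single class; it is nonempty by reflexivity.\<close>

lemma presented_group_mult:
  assumes "u \<in> lists (UNIV \<times> X)" "w \<in> lists (UNIV \<times> X)"
  shows "pres_cong X rels `` {u} \<otimes>\<^bsub>presented_group X rels\<^esub> pres_cong X rels `` {w}
    = pres_cong X rels `` {u @ w}"
proof -
  have *: "pres_cong X rels `` {u' @ w'} = pres_cong X rels `` {u @ w}"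
    if "u' \<in> pres_cong X rels `` {u}" "w' \<in> pres_cong X rels `` {w}" for u' w'
    using equiv_class_eq[OF equiv_pres_cong pres_cong_append[of u u' X rels w w']] that by simp
  have ne: "pres_cong X rels `` {u} \<noteq> {}" "pres_cong X rels `` {w} \<noteq> {}"
    using pres_cong.refl[OF assms(1)] pres_cong.refl[OF assms(2)] by blast+
  have "(\<Union>u'\<in>pres_cong X rels `` {u}. \<Union>w'\<in>pres_cong X rels `` {w}. pres_cong X rels `` {u' @ w'})
      = (\<Union>u'\<in>pres_cong X rels `` {u}. \<Union>w'\<in>pres_cong X rels `` {w}. pres_cong X rels `` {u @ w})"
    by (intro SUP_cong HOL.refl *)
  also have "\<dots> = pres_cong X rels `` {u @ w}"
    using ne by (simp only: UN_constant if_False)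
  finally have "(\<Union>u'\<in>pres_cong X rels `` {u}. \<Union>w'\<in>pres_cong X rels `` {w}. pres_cong X rels `` {u' @ w'})
      = pres_cong X rels `` {u @ w}" .
  then show ?thesis by (simp add: presented_group_def)
qed

lemma presented_group_cases:
  assumes "U \<in> carrier (presented_group X rels)"
  obtains u where "u \<in> lists (UNIV \<times> X)" "U = pres_cong X rels `` {u}"
proof -
  have "U \<in> lists (UNIV \<times> X) // pres_cong X rels" using assms by (simp add: presented_group_def)
  then show thesis by (rule quotientE) (rule that)
qed

lemma presented_group_class_in:
  "u \<in> lists (UNIV \<times> X) \<Longrightarrow> pres_cong X rels `` {u} \<in> carrier (presented_group X rels)"
  by (simp add: presented_group_def quotientI)

lemma presented_group_one: "\<one>\<^bsub>presented_group X rels\<^esub> = pres_cong X rels `` {[]}"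
  by (simp add: presented_group_def)

lemma monoid_presented_group: "Group.monoid (presented_group X rels)" (is "Group.monoid ?G")
proof (rule monoidI)
  fix U V W assume "U \<in> carrier ?G" "V \<in> carrier ?G"
  then obtain u v where uv: "u \<in> lists (UNIV \<times> X)" "U = pres_cong X rels `` {u}"
    "v \<in> lists (UNIV \<times> X)" "V = pres_cong X rels `` {v}"
    by (metis presented_group_cases)
  then show "U \<otimes>\<^bsub>?G\<^esub> V \<in> carrier ?G"
    by (simp add: presented_group_mult presented_group_class_in)
  assume "W \<in> carrier ?G"
  then obtain w where "w \<in> lists (UNIV \<times> X)" "W = pres_cong X rels `` {w}"
    by (metis presented_group_cases)
  with uv show "U \<otimes>\<^bsub>?G\<^esub> V \<otimes>\<^bsub>?G\<^esub> W = U \<otimes>\<^bsub>?G\<^esub> (V \<otimes>\<^bsub>?G\<^esub> W)"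
    by (simp add: presented_group_mult)
next
  show "\<one>\<^bsub>?G\<^esub> \<in> carrier ?G" by (simp add: presented_group_one presented_group_class_in)
next
  fix U assume "U \<in> carrier ?G"
  then obtain u where u: "u \<in> lists (UNIV \<times> X)" "U = pres_cong X rels `` {u}"
    by (metis presented_group_cases)
  then show "\<one>\<^bsub>?G\<^esub> \<otimes>\<^bsub>?G\<^esub> U = U" "U \<otimes>\<^bsub>?G\<^esub> \<one>\<^bsub>?G\<^esub> = U"
    using presented_group_mult[of "[]" X u] presented_group_mult[of u X "[]"]
    by (simp_all add: presented_group_one)
qed

text \<open>Words are evaluated letter by letter. Cancellation occurs with either sign first, so
  \<open>w x\<close> has to be an inverse of \<open>u x\<close> on both sides.\<close>

lemma presented_group_hom:
  fixes H (structure)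
  assumes "Group.monoid H"
    and uw: "\<And>x. x \<in> X \<Longrightarrow> u x \<in> carrier H" "\<And>x. x \<in> X \<Longrightarrow> w x \<in> carrier H"
    and inv: "\<And>x. x \<in> X \<Longrightarrow> u x \<otimes> w x = \<one>" "\<And>x. x \<in> X \<Longrightarrow> w x \<otimes> u x = \<one>"
    and rels: "\<And>l r. (l, r) \<in> rels \<Longrightarrow> l \<in> lists (UNIV \<times> X) \<Longrightarrow> r \<in> lists (UNIV \<times> X)
      \<Longrightarrow> word_eval H u w l = word_eval H u w r"
  obtains \<phi> where "\<phi> \<in> hom (presented_group X rels) H" "\<phi> \<one>\<^bsub>presented_group X rels\<^esub> = \<one>"
    "\<And>x. x \<in> X \<Longrightarrow> \<phi> (pres_gen X rels x) = u x"
proof -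
  interpret H: Group.monoid H by fact
  let ?ev = "word_eval H u w"
  have closed: "?ev ws \<in> carrier H" if "ws \<in> lists (UNIV \<times> X)" for ws
    using that
  proof (induction ws)
    case (Cons a ws)
    then show ?case using uw by (cases a) auto
  qed simp
  have append: "?ev (v @ ws) = ?ev v \<otimes> ?ev ws" if "v \<in> lists (UNIV \<times> X)" "ws \<in> lists (UNIV \<times> X)" for v ws
    using that(1)
  proof (induction v)
    case Nil
    then show ?case using closed[OF that(2)] by simp
  next
    case (Cons a v)
    then show ?case using uw closed that(2) by (cases a) (auto simp: H.m_assoc)
  qed
  have cong: "?ev v = ?ev ws" if "(v, ws) \<in> pres_cong X rels" for v ws
    using that
  proof (induction rule: pres_cong.induct)
    case (cong v ws p q)
    then show ?case using pres_cong_words[OF cong(1)] by (simp add: append)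
  next
    case (cancel x b)
    then show ?case using uw inv by (cases b) auto
  next
    case (rel l r)
    then show ?case by (rule rels)
  qed simp_all
  \<comment> \<open>Evaluate any representative; \<open>cong\<close> makes the choice
    irrelevant.\<close>
  define \<phi> where "\<phi> U = ?ev (SOME v. v \<in> U)" for U
  have \<phi>: "\<phi> (pres_cong X rels `` {v}) = ?ev v" if v: "v \<in> lists (UNIV \<times> X)" for v
  proof -
    have "v \<in> pres_cong X rels `` {v}" using v by (auto intro: pres_cong.refl)
    then have "(SOME v'. v' \<in> pres_cong X rels `` {v}) \<in> pres_cong X rels `` {v}" by (rule someI)
    then show ?thesis using cong unfolding \<phi>_def by simp
  qed
  show ?thesis
  proof
    show "\<phi> \<in> hom (presented_group X rels) H"
    proof (rule homI)
      fix U assume "U \<in> carrier (presented_group X rels)"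
      then obtain v where v: "v \<in> lists (UNIV \<times> X)" "U = pres_cong X rels `` {v}"
        by (rule presented_group_cases)
      then show "\<phi> U \<in> carrier H" using \<phi> closed by simp
      fix W assume "W \<in> carrier (presented_group X rels)"
      then obtain ws where "ws \<in> lists (UNIV \<times> X)" "W = pres_cong X rels `` {ws}"
        by (rule presented_group_cases)
      with v show "\<phi> (U \<otimes>\<^bsub>presented_group X rels\<^esub> W) = \<phi> U \<otimes> \<phi> W"
        by (simp add: presented_group_mult \<phi> append)
    qed
    show "\<phi> \<one>\<^bsub>presented_group X rels\<^esub> = \<one>" by (simp add: presented_group_one \<phi>)
    show "\<phi> (pres_gen X rels x) = u x" if "x \<in> X" for x
      using \<phi>[of "[(True, x)]"] that uw by (simp add: pres_gen_def)
  qed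
qed

section \<open>The universal property of a monoid algebra\<close>

text \<open>Linear extension of a monoid homomorphism; multiplicativity is bilinear in both
  arguments and therefore reduces to single terms, where it is the homomorphism property of
  \<open>\<phi>\<close>.\<close>

lemma (in scalar_algebra) monoid_algebra_hom:
  assumes "Group.monoid G" and \<phi>: "\<phi> \<in> hom G N" "\<phi> \<one>\<^bsub>G\<^esub> = \<one>"
  obtains \<rho> where "\<rho> \<in> algebra_hom (monoid_algebra G) N"
    "\<And>g. g \<in> carrier G \<Longrightarrow> \<rho> (Poly_Mapping.single g 1) = \<phi> g"
proof -
  interpret G: Group.monoid G by fact
  let ?A = "monoid_algebra G :: ('r, _) module"
  define \<rho> where "\<rho> f = (\<Oplus>g\<in>Poly_Mapping.keys f. Poly_Mapping.lookup f g \<odot> \<phi> g)" for f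
  have \<phi>_in [simp]: "\<phi> g \<in> carrier N" if "g \<in> carrier G" for g
    using \<phi> that by (auto simp: hom_def)
  have carr: "carrier ?A = {f. Poly_Mapping.keys f \<subseteq> carrier G}"
    by (simp add: monoid_algebra_def)
  \<comment> \<open>Summing over a common larger set is what allows elements with different supports
    to be added.\<close>
  have superset: "\<rho> f = (\<Oplus>g\<in>S. Poly_Mapping.lookup f g \<odot> \<phi> g)"
    if "finite S" "Poly_Mapping.keys f \<subseteq> S" "S \<subseteq> carrier G" for f S
    unfolding \<rho>_def
    by (rule add.finprod_mono_neutral_cong_left) (use that in \<open>auto simp: in_keys_iff\<close>)
  have closed: "\<rho> f \<in> carrier N" if "f \<in> carrier ?A" for f
    unfolding \<rho>_def by (rule finsum_closed) (use that in \<open>auto simp: carr\<close>)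
  have \<rho>_add: "\<rho> (f + g) = \<rho> f \<oplus> \<rho> g"
    if "Poly_Mapping.keys f \<subseteq> carrier G" "Poly_Mapping.keys g \<subseteq> carrier G" for f g
  proof -
    let ?S = "Poly_Mapping.keys f \<union> Poly_Mapping.keys g"
    have S: "finite ?S" "?S \<subseteq> carrier G" using that by auto
    have "\<rho> (f + g) = (\<Oplus>x\<in>?S. Poly_Mapping.lookup f x \<odot> \<phi> x \<oplus> Poly_Mapping.lookup g x \<odot> \<phi> x)"
      unfolding superset[OF S(1) keys_add S(2)]
      by (rule finsum_cong') (use S in \<open>auto simp: lookup_add smult_l_distr\<close>)
    also have "\<dots> = (\<Oplus>x\<in>?S. Poly_Mapping.lookup f x \<odot> \<phi> x) \<oplus> (\<Oplus>x\<in>?S. Poly_Mapping.lookup g x \<odot> \<phi> x)"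
      by (rule finsum_addf) (use S in auto)
    finally show ?thesis using superset[OF S(1) _ S(2)] by simp
  qed
  have \<rho>_single: "\<rho> (Poly_Mapping.single g a) = a \<odot> \<phi> g" if "g \<in> carrier G" for g a
    using superset[of "{g}" "Poly_Mapping.single g a"] that by simp
  have \<rho>_zero: "\<rho> 0 = \<zero>" by (simp add: \<rho>_def)
  have mult: "\<rho> (f \<otimes>\<^bsub>?A\<^esub> g) = \<rho> f \<otimes> \<rho> g" if "f \<in> carrier ?A" "g \<in> carrier ?A" for f g
  proof -
    interpret SC: structure_constants "carrier G" "mult G" "\<lambda>_ _. 1 :: 'r" "\<one>\<^bsub>G\<^esub>"
      by unfold_locales (auto simp: G.m_assoc)
    have f: "Poly_Mapping.keys f \<subseteq> carrier G" and g: "Poly_Mapping.keys g \<subseteq> carrier G"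
      using that by (auto simp: carr)
    from f show ?thesis
      unfolding monoid_algebra_def
    proof (induction f rule: keys_subset_induct)
      case zero
      then show ?case using closed that \<rho>_zero by simp
    next
      case (single x a)
      note x = this
      from g show ?case
      proof (induction g rule: keys_subset_induct)
        case zero
        then show ?case using x \<rho>_zero \<rho>_single by simp
      next
        case (single y b)
        have "\<phi> (x \<otimes>\<^bsub>G\<^esub> y) = \<phi> x \<otimes> \<phi> y" using x single \<phi>(1) by (simp add: hom_mult)
        then show ?case
          using x single \<rho>_single
          by (simp add: smult_l_assoc smult_r_assoc mult.commute flip: smult_assoc1)
      next
        case (add g g')
        then show ?case
          using x closed[of g] closed[of g'] closed[of "Poly_Mapping.single x a"]
            SC.basis_mult_closed[of "Poly_Mapping.single x a" g]
            SC.basis_mult_closed[of "Poly_Mapping.single x a" g']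
          by (simp add: basis_mult_add_right \<rho>_add r_distr carr)
      qed
    next
      case (add f f')
      then show ?case
        using g closed[of f] closed[of f'] closed[of g] SC.basis_mult_closed[of f g] SC.basis_mult_closed[of f' g]
        by (simp add: basis_mult_add_left \<rho>_add l_distr carr)
    qed
  qed
  have smult: "\<rho> (r \<odot>\<^bsub>?A\<^esub> f) = r \<odot> \<rho> f" if "f \<in> carrier ?A" for r f
  proof -
    have "Poly_Mapping.keys f \<subseteq> carrier G" using that by (simp add: carr)
    then have "\<rho> (Poly_Mapping.map ((*) r) f) = r \<odot> \<rho> f"
    proof (induction f rule: keys_subset_induct)
      case zero
      then show ?case using smult_zero_right by (simp add: map_mult_zero \<rho>_zero)
    next
      case (single x a)
      then show ?case by (simp add: map_mult_single \<rho>_single smult_assoc1)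
    next
      case (add f g)
      then show ?case
        using closed[of f] closed[of g]
          \<rho>_add[OF order_trans[OF keys_map_mult add(1)] order_trans[OF keys_map_mult add(2)]]
        by (simp add: map_mult_add \<rho>_add smult_r_distr carr)
    qed
    then show ?thesis by (simp add: monoid_algebra_def)
  qed
  show ?thesis
  proof
    show "\<rho> \<in> algebra_hom ?A N"
      unfolding algebra_hom_def
    proof (intro CollectI conjI allI ballI)
      show "\<rho> \<in> ring_hom ?A N"
        by (rule ring_hom_memI)
          (use closed mult \<rho>_add \<rho>_single \<phi>(2) in \<open>simp_all add: carr monoid_algebra_def\<close>)
    qed (rule smult)
  qed (simp add: \<rho>_single)
qed

section \<open>The virtual Temperley--Lieb algebra\<close>

lemma mmul_id_left: "X \<subseteq> {1..n} \<Longrightarrow> mmul n (\<lambda>X Y. of_bool (X = Y)) B X Y = B X Y"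
proof -
  assume X: "X \<subseteq> {1..n}"
  have "mmul n (\<lambda>X Y. of_bool (X = Y)) B X Y = (\<Sum>Z\<in>Pow {1..n}. if X = Z then B Z Y else 0)"
    unfolding mmul_def by (intro sum.cong) auto
  then show ?thesis using X by simp
qed

lemma mmul_id_right: "Y \<subseteq> {1..n} \<Longrightarrow> mmul n B (\<lambda>X Y. of_bool (X = Y)) X Y = B X Y"
proof -
  assume Y: "Y \<subseteq> {1..n}"
  have "mmul n B (\<lambda>X Y. of_bool (X = Y)) X Y = (\<Sum>Z\<in>Pow {1..n}. if Z = Y then B X Z else 0)"
    unfolding mmul_def by (intro sum.cong) auto
  then show ?thesis using Y by simp
qed

text \<open>Both bracketings are represented by the same triple matrix product, so
  \<open>represents_unique\<close> gives equality of the tangles and of the total numbers of closed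
  curves at once. The unit laws follow in the same way from the identity matrix.\<close>

lemma structure_constants_VTL:
  "structure_constants (tangles n) (tangle_comp n) (\<lambda>E E'. [:0, 1:] ^ closed_curves n E E' :: int poly)
    (id_tangle n)"
proof
  fix E F assume E: "E \<in> tangles n" and F: "F \<in> tangles n"
  then show "tangle_comp n E F \<in> tangles n"
    by (intro glued_tangles.tangle_comp_closed glued_tangles.intro)
  note E = represents_tangle[OF E] and F = represents_tangle[OF F]
  have "closed_curves n (id_tangle n) E = 0 \<and> tangle_comp n (id_tangle n) E = E"
    using represents_unique[OF represents_mult[OF represents_id E] E] mmul_id_left by simp
  then show "tangle_comp n (id_tangle n) E = E" "[:0, 1:] ^ closed_curves n (id_tangle n) E = (1 :: int poly)"
    by simp_all
  have "closed_curves n E (id_tangle n) = 0 \<and> tangle_comp n E (id_tangle n) = E"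
    using represents_unique[OF represents_mult[OF E represents_id] E] mmul_id_right by simp
  then show "tangle_comp n E (id_tangle n) = E" "[:0, 1:] ^ closed_curves n E (id_tangle n) = (1 :: int poly)"
    by simp_all
  fix G assume "G \<in> tangles n"
  note G = represents_tangle[OF this]
  have "closed_curves n E F + closed_curves n (tangle_comp n E F) G
      = closed_curves n F G + closed_curves n E (tangle_comp n F G)
    \<and> tangle_comp n (tangle_comp n E F) G = tangle_comp n E (tangle_comp n F G)"
    using represents_unique[OF represents_mult[OF represents_mult[OF E F] G]
      represents_mult[OF E represents_mult[OF F G]]] by (simp add: mmul_assoc)
  then show "tangle_comp n (tangle_comp n E F) G = tangle_comp n E (tangle_comp n F G)"
    "[:0, 1:] ^ closed_curves n E F * [:0, 1:] ^ closed_curves n (tangle_comp n E F) G =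
      ([:0, 1:] ^ closed_curves n F G * [:0, 1:] ^ closed_curves n E (tangle_comp n F G) :: int poly)"
    by (simp_all flip: power_add)
qed (rule id_tangle_in)

interpretation VTL: scalar_algebra "VTL n" for n
  unfolding VTL_def by (rule structure_constants.scalar_algebra_basis_algebra[OF structure_constants_VTL])

interpretation ext: scalar_extension "VTL n" R0_emb for n
  by unfold_locales

interpretation VTL_Rf: scalar_algebra "VTL_Rf n" for n
  unfolding VTL_Rf_def by (rule ext.scalar_algebra_N)

abbreviation tangle_single :: "tangle \<Rightarrow> tangle \<Rightarrow>\<^sub>0 int poly" where
  "tangle_single E \<equiv> Poly_Mapping.single E 1"

text \<open>Carries the comparison of monomials over to elements of the algebra, so that an identity
  between products can be proved by comparing matrices.\<close>

definition VTL_represents :: "nat \<Rightarrow> (tangle \<Rightarrow>\<^sub>0 int poly) \<Rightarrow> (nat set \<Rightarrow> nat set \<Rightarrow> nat) \<Rightarrow> bool" where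
  "VTL_represents n f A \<longleftrightarrow> (\<exists>k E. represents n k E A \<and> f = Poly_Mapping.single E ([:0, 1:] ^ k))"

lemma VTL_represents_mult:
  assumes "VTL_represents n f A" "VTL_represents n g B"
  shows "VTL_represents n (f \<otimes>\<^bsub>VTL n\<^esub> g) (mmul n A B)"
proof -
  obtain k E l F where A: "represents n k E A" "f = Poly_Mapping.single E ([:0, 1:] ^ k)"
    and B: "represents n l F B" "g = Poly_Mapping.single F ([:0, 1:] ^ l)"
    using assms by (auto simp: VTL_represents_def)
  have "f \<otimes>\<^bsub>VTL n\<^esub> g = Poly_Mapping.single (tangle_comp n E F) ([:0, 1:] ^ (k + l + closed_curves n E F))"
    by (simp add: VTL_def A B power_add)
  then show ?thesis using represents_mult[OF A(1) B(1)] by (auto simp: VTL_represents_def)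
qed

lemma VTL_represents_unique:
  assumes "VTL_represents n f A" "VTL_represents n g B"
    and "\<And>X Y. X \<subseteq> {1..n} \<Longrightarrow> Y \<subseteq> {1..n} \<Longrightarrow> A X Y = B X Y"
  shows "f = g"
proof -
  obtain k E l F where A: "represents n k E A" "f = Poly_Mapping.single E ([:0, 1:] ^ k)"
    and B: "represents n l F B" "g = Poly_Mapping.single F ([:0, 1:] ^ l)"
    using assms(1,2) by (auto simp: VTL_represents_def)
  then show ?thesis using represents_unique[OF A(1) B(1) assms(3)] by simp
qed

lemma VTL_represents_tangle: "represents n 0 E A \<Longrightarrow> VTL_represents n (tangle_single E) A"
  unfolding VTL_represents_def by (intro exI[of _ 0] exI[of _ E]) simp

lemma VTL_one: "\<one>\<^bsub>VTL n\<^esub> = tangle_single (id_tangle n)"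
  by (simp add: VTL_def)

lemma tangle_single_in: "E \<in> tangles n \<Longrightarrow> tangle_single E \<in> carrier (VTL n)"
  by (simp add: VTL_def)

section \<open>Relations between the tangles \<open>E_i\<close> and \<open>v_i\<close> over the
  polynomial ring\<close>

context
  fixes n :: nat
begin

abbreviation E_single :: "nat \<Rightarrow> tangle \<Rightarrow>\<^sub>0 int poly" where "E_single i \<equiv> tangle_single (E_tangle n i)"
abbreviation v_single :: "nat \<Rightarrow> tangle \<Rightarrow>\<^sub>0 int poly" where "v_single i \<equiv> tangle_single (v_tangle n i)"

lemma VTL_represents_e: "i \<in> {1..n - 1} \<Longrightarrow> VTL_represents n (E_single i) (Emat i (i + 1))"
  by (rule VTL_represents_tangle[OF represents_E])

lemma VTL_represents_v: "i \<in> {1..n - 1} \<Longrightarrow> VTL_represents n (v_single i) (vmat i (i + 1))"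
  by (rule VTL_represents_tangle[OF represents_v])

lemma VTL_e_square:
  assumes i: "i \<in> {1..n - 1}"
  shows "E_single i \<otimes>\<^bsub>VTL n\<^esub> E_single i = [:0, 1:] \<odot>\<^bsub>VTL n\<^esub> E_single i"
proof (rule VTL_represents_unique)
  show "VTL_represents n (E_single i \<otimes>\<^bsub>VTL n\<^esub> E_single i) (mmul n (Emat i (i + 1)) (Emat i (i + 1)))"
    by (intro VTL_represents_mult VTL_represents_e i)
  \<comment> \<open>The factor 2 of the matrix is absorbed as exponent 1, the coefficient
    \<open>z\<close> in the algebra.\<close>
  have "represents n 1 (E_tangle n i) (\<lambda>X Y. 2 * Emat i (i + 1) X Y)"
    using represents_E[OF i] by (simp add: represents_def)
  moreover have "[:0, 1:] \<odot>\<^bsub>VTL n\<^esub> E_single i = Poly_Mapping.single (E_tangle n i) ([:0, 1:] ^ 1)"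
    by (simp add: VTL_def map_mult_single)
  ultimately show "VTL_represents n ([:0, 1:] \<odot>\<^bsub>VTL n\<^esub> E_single i) (\<lambda>X Y. 2 * Emat i (i + 1) X Y)"
    unfolding VTL_represents_def by blast
  show "mmul n (Emat i (i + 1)) (Emat i (i + 1)) X Y = 2 * Emat i (i + 1) X Y"
    if "X \<subseteq> {1..n}" "Y \<subseteq> {1..n}" for X Y
    by (rule Emat_square) (use i that in auto)
qed

lemma VTL_v_square:
  assumes i: "i \<in> {1..n - 1}"
  shows "v_single i \<otimes>\<^bsub>VTL n\<^esub> v_single i = \<one>\<^bsub>VTL n\<^esub>"
  unfolding VTL_one
  by (rule VTL_represents_unique[OF VTL_represents_mult[OF VTL_represents_v[OF i] VTL_represents_v[OF i]]
        VTL_represents_tangle[OF represents_id]], rule vmat_square) (use i in auto)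

lemma VTL_far:
  assumes i: "i \<in> {1..n - 1}" and j: "j \<in> {1..n - 1}" and ij: "\<bar>int i - int j\<bar> \<ge> 2"
  shows "E_single i \<otimes>\<^bsub>VTL n\<^esub> E_single j = E_single j \<otimes>\<^bsub>VTL n\<^esub> E_single i"
    and "v_single i \<otimes>\<^bsub>VTL n\<^esub> v_single j = v_single j \<otimes>\<^bsub>VTL n\<^esub> v_single i"
    and "v_single i \<otimes>\<^bsub>VTL n\<^esub> E_single j = E_single j \<otimes>\<^bsub>VTL n\<^esub> v_single i"
proof -
  have d: "distinct [i, i + 1, j, j + 1]" "distinct [j, j + 1, i, i + 1]" using ij by auto
  have N: "{i, i + 1, j, j + 1} \<subseteq> {1..n}" using i j by auto
  note r = VTL_represents_mult VTL_represents_e[OF i] VTL_represents_e[OF j]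
    VTL_represents_v[OF i] VTL_represents_v[OF j]
  show "E_single i \<otimes>\<^bsub>VTL n\<^esub> E_single j = E_single j \<otimes>\<^bsub>VTL n\<^esub> E_single i"
  proof (rule VTL_represents_unique[OF r(1)[OF r(2,3)] r(1)[OF r(3,2)]])
    show "mmul n (Emat i (i + 1)) (Emat j (j + 1)) X Y = mmul n (Emat j (j + 1)) (Emat i (i + 1)) X Y"
      if "X \<subseteq> {1..n}" "Y \<subseteq> {1..n}" for X Y
      \<comment> \<open>The two closed forms differ only in the order of their conjuncts and of the
        listed points.\<close>
      unfolding Emat_far[OF d(1) that] Emat_far[OF d(2) that]
      by (rule arg_cong[where f = of_bool]) blast
  qed
  show "v_single i \<otimes>\<^bsub>VTL n\<^esub> v_single j = v_single j \<otimes>\<^bsub>VTL n\<^esub> v_single i"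
    by (rule VTL_represents_unique[OF r(1)[OF r(4,5)] r(1)[OF r(5,4)]]) (rule vmat_far[OF d(1) N])
  show "v_single i \<otimes>\<^bsub>VTL n\<^esub> E_single j = E_single j \<otimes>\<^bsub>VTL n\<^esub> v_single i"
    by (rule VTL_represents_unique[OF r(1)[OF r(4,3)] r(1)[OF r(3,4)]]) (rule vmat_Emat_far[OF d(1) N])
qed

lemma VTL_near:
  assumes i: "i \<in> {1..n - 1}" and j: "j \<in> {1..n - 1}" and ij: "\<bar>int i - int j\<bar> = 1"
  shows "E_single i \<otimes>\<^bsub>VTL n\<^esub> E_single j \<otimes>\<^bsub>VTL n\<^esub> E_single i = E_single i"
    and "v_single i \<otimes>\<^bsub>VTL n\<^esub> v_single j \<otimes>\<^bsub>VTL n\<^esub> v_single i = v_single j \<otimes>\<^bsub>VTL n\<^esub> v_single i \<otimes>\<^bsub>VTL n\<^esub> v_single j"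
    and "v_single i \<otimes>\<^bsub>VTL n\<^esub> v_single j \<otimes>\<^bsub>VTL n\<^esub> E_single i = E_single j \<otimes>\<^bsub>VTL n\<^esub> v_single i \<otimes>\<^bsub>VTL n\<^esub> v_single j"
proof -
  \<comment> \<open>\<open>m\<close> is the point shared by the two adjacent pairs. If
    \<open>i\<close> is the larger index, the three points are listed in descending order, so one
    set of matrix lemmas covers both cases.\<close>
  obtain a m b where d: "distinct [a, m, b]" and N: "{a, m, b} \<subseteq> {1..n}"
    and r: "VTL_represents n (E_single i) (Emat a m)" "VTL_represents n (E_single j) (Emat m b)"
      "VTL_represents n (v_single i) (vmat a m)" "VTL_represents n (v_single j) (vmat m b)"
  proof (cases "j = i + 1")
    case True
    show ?thesis
      by (rule that[of i "i + 1" "i + 2"])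
        (use True i j VTL_represents_e[OF i] VTL_represents_e[OF j] VTL_represents_v[OF i]
          VTL_represents_v[OF j] in auto)
  next
    case False
    then have "i = j + 1" using ij by auto
    then show ?thesis
      by (intro that[of "j + 2" "j + 1" j])
        (use i j VTL_represents_e[OF i] VTL_represents_e[OF j] VTL_represents_v[OF i]
          VTL_represents_v[OF j] in \<open>auto simp: cup_cap_commute swap_set_commute\<close>)
  qed
  note mult = VTL_represents_mult
  show "E_single i \<otimes>\<^bsub>VTL n\<^esub> E_single j \<otimes>\<^bsub>VTL n\<^esub> E_single i = E_single i"
    by (rule VTL_represents_unique[OF mult[OF mult[OF r(1,2)] r(1)] r(1)])
      (rule Emat_near_triple[OF d _ _ N])
  show "v_single i \<otimes>\<^bsub>VTL n\<^esub> v_single j \<otimes>\<^bsub>VTL n\<^esub> v_single i = v_single j \<otimes>\<^bsub>VTL n\<^esub> v_single i \<otimes>\<^bsub>VTL n\<^esub> v_single j"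
    by (rule VTL_represents_unique[OF mult[OF mult[OF r(3,4)] r(3)] mult[OF mult[OF r(4,3)] r(4)]])
      (rule vmat_braid[OF d N])
  show "v_single i \<otimes>\<^bsub>VTL n\<^esub> v_single j \<otimes>\<^bsub>VTL n\<^esub> E_single i = E_single j \<otimes>\<^bsub>VTL n\<^esub> v_single i \<otimes>\<^bsub>VTL n\<^esub> v_single j"
    by (rule VTL_represents_unique[OF mult[OF mult[OF r(3,4)] r(1)] mult[OF mult[OF r(2,3)] r(4)]])
      (rule vmat_Emat_near[OF d N])
qed

end

section \<open>Quadratic elements and braid relations\<close>

context scalar_algebra
begin

lemma smult_smult: "x \<in> carrier N \<Longrightarrow> r \<odot> (s \<odot> x) = (r * s) \<odot> x"
  by (simp add: smult_assoc1)

lemmas smult_distribs = l_distr r_distr smult_l_assoc smult_r_assoc smult_r_distr smult_smult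

lemma affine_mult:
  assumes "x \<in> carrier N" "y \<in> carrier N"
  shows "(a \<odot> \<one> \<oplus> b \<odot> x) \<otimes> (c \<odot> \<one> \<oplus> d \<odot> y) =
    (a * c) \<odot> \<one> \<oplus> ((b * c) \<odot> x \<oplus> (a * d) \<odot> y) \<oplus> (b * d) \<odot> (x \<otimes> y)"
  using assms by (simp add: smult_distribs a_ac mult.commute)

text \<open>By \<open>x \<otimes> x = z \<odot> x\<close> the span of the unit and \<open>x\<close>
  is closed under multiplication; the last two hypotheses compare the coefficients of the unit and
  of \<open>x\<close>.\<close>

lemma affine_inverse:
  assumes x: "x \<in> carrier N" and sq: "x \<otimes> x = z \<odot> x"
    and "a * c = 1" "a * d + b * c + b * d * z = 0"
  shows "(a \<odot> \<one> \<oplus> b \<odot> x) \<otimes> (c \<odot> \<one> \<oplus> d \<odot> x) = \<one>"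
proof -
  have "(a \<odot> \<one> \<oplus> b \<odot> x) \<otimes> (c \<odot> \<one> \<oplus> d \<odot> x)
      = (a * c) \<odot> \<one> \<oplus> (b * c + a * d + b * d * z) \<odot> x"
    using x by (simp add: affine_mult sq smult_smult smult_l_distr a_assoc)
  also have "b * c + a * d + b * d * z = 0" using assms(4) by (simp add: add_ac)
  finally show ?thesis using x assms(3) by simp
qed

lemma affine_commute:
  assumes "x \<in> carrier N" "y \<in> carrier N" "x \<otimes> y = y \<otimes> x"
  shows "(a \<odot> \<one> \<oplus> b \<odot> x) \<otimes> (a \<odot> \<one> \<oplus> b \<odot> y) = (a \<odot> \<one> \<oplus> b \<odot> y) \<otimes> (a \<odot> \<one> \<oplus> b \<odot> x)"
  unfolding affine_mult[OF assms(1,2)] affine_mult[OF assms(2,1)] assms(3)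
  using assms(1,2) by (simp add: a_ac mult.commute)

lemma affine_intertwine:
  assumes "x \<in> carrier N" "y \<in> carrier N" "t \<in> carrier N" "t \<otimes> x = y \<otimes> t"
  shows "t \<otimes> (a \<odot> \<one> \<oplus> b \<odot> x) = (a \<odot> \<one> \<oplus> b \<odot> y) \<otimes> t"
  using assms by (simp add: l_distr r_distr smult_l_assoc smult_r_assoc)

text \<open>The right-hand side is symmetric in \<open>x\<close> and \<open>y\<close>, from which
  the braid relation is read off. The hypothesis on \<open>a\<close> and \<open>b\<close> removes
  the only unsymmetric contribution.\<close>

lemma affine_braid_expand:
  assumes x: "x \<in> carrier N" and y: "y \<in> carrier N"
    and sq: "x \<otimes> x = z \<odot> x" and xyx: "x \<otimes> y \<otimes> x = x"
    and ab: "a * a + a * b * z + b * b = 0"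
  shows "(a \<odot> \<one> \<oplus> b \<odot> x) \<otimes> (a \<odot> \<one> \<oplus> b \<odot> y) \<otimes> (a \<odot> \<one> \<oplus> b \<odot> x) =
    (a * a * a) \<odot> \<one> \<oplus> ((a * a * b) \<odot> x \<oplus> (a * a * b) \<odot> y)
      \<oplus> ((a * b * b) \<odot> (x \<otimes> y) \<oplus> (a * b * b) \<odot> (y \<otimes> x))"
proof -
  define p where "p = (a \<odot> \<one> \<oplus> b \<odot> x) \<otimes> (a \<odot> \<one> \<oplus> b \<odot> y)"
  have p: "p = (a * a) \<odot> \<one> \<oplus> ((b * a) \<odot> x \<oplus> (a * b) \<odot> y) \<oplus> (b * b) \<odot> (x \<otimes> y)"
    unfolding p_def using x y by (rule affine_mult)
  have pN: "p \<in> carrier N" unfolding p_def using x y by simp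
  \<comment> \<open>Three terms of \<open>p \<otimes> x\<close> are multiples of \<open>x\<close>:
    one from the unit, one from the square of \<open>x\<close>, and one from
    \<open>x \<otimes> y \<otimes> x\<close>. Their coefficients add up to the vanishing
    expression.\<close>
  have "p \<otimes> x = (a * a) \<odot> x \<oplus> ((b * a * z) \<odot> x \<oplus> (a * b) \<odot> (y \<otimes> x)) \<oplus> (b * b) \<odot> x"
    unfolding p using x y by (simp add: l_distr smult_l_assoc sq smult_smult xyx)
  also have "\<dots> = ((a * a) \<odot> x \<oplus> (b * a * z) \<odot> x \<oplus> (b * b) \<odot> x) \<oplus> (a * b) \<odot> (y \<otimes> x)"
    using x y by (simp add: a_ac)
  also have "(a * a) \<odot> x \<oplus> (b * a * z) \<odot> x \<oplus> (b * b) \<odot> x = (a * a + a * b * z + b * b) \<odot> x"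
    using x by (simp add: smult_l_distr mult.commute)
  finally have px: "p \<otimes> x = (a * b) \<odot> (y \<otimes> x)" using x y by (simp add: ab)
  have "p \<otimes> (a \<odot> \<one> \<oplus> b \<odot> x) = a \<odot> p \<oplus> b \<odot> (p \<otimes> x)"
    using x pN by (simp add: r_distr smult_r_assoc)
  also have "\<dots> = (a * a * a) \<odot> \<one> \<oplus> ((a * a * b) \<odot> x \<oplus> (a * a * b) \<odot> y)
      \<oplus> (a * b * b) \<odot> (x \<otimes> y) \<oplus> (a * b * b) \<odot> (y \<otimes> x)"
    unfolding px unfolding p using x y by (simp add: smult_r_distr smult_smult mult_ac)
  finally show ?thesis unfolding p_def using x y by (simp add: a_assoc)
qed

lemma affine_braid:
  assumes "x \<in> carrier N" "y \<in> carrier N" "x \<otimes> x = z \<odot> x" "y \<otimes> y = z \<odot> y"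
    "x \<otimes> y \<otimes> x = x" "y \<otimes> x \<otimes> y = y" "a * a + a * b * z + b * b = 0"
  shows "(a \<odot> \<one> \<oplus> b \<odot> x) \<otimes> (a \<odot> \<one> \<oplus> b \<odot> y) \<otimes> (a \<odot> \<one> \<oplus> b \<odot> x) =
    (a \<odot> \<one> \<oplus> b \<odot> y) \<otimes> (a \<odot> \<one> \<oplus> b \<odot> x) \<otimes> (a \<odot> \<one> \<oplus> b \<odot> y)"
  unfolding affine_braid_expand[OF assms(1,2,3,5,7)] affine_braid_expand[OF assms(2,1,4,6,7)]
  using assms(1,2) by (simp add: a_ac)

end

section \<open>Laurent coefficients and the images of the generators\<close>

lemma A_pow_mult: "A_pow k * A_pow l = A_pow (k + l)"
  by (simp add: A_pow_def mult_single)

lemma A_pow_0: "A_pow 0 = 1"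
  by (simp add: A_pow_def)

lemma R0_emb_z: "R0_emb [:0, 1:] = - A_pow 2 - A_pow (-2)"
  by (simp add: R0_emb_def map_poly_pCons)

context
  fixes n :: nat
begin

abbreviation (input) E_elt :: "nat \<Rightarrow> ((laurent \<times> (tangle \<Rightarrow>\<^sub>0 int poly)) \<Rightarrow>\<^sub>0 int) set" where
  "E_elt i \<equiv> tangle_elt n (E_tangle n i)"

abbreviation (input) v_elt :: "nat \<Rightarrow> ((laurent \<times> (tangle \<Rightarrow>\<^sub>0 int poly)) \<Rightarrow>\<^sub>0 int) set" where
  "v_elt i \<equiv> tangle_elt n (v_tangle n i)"

abbreviation to_Rf :: "(tangle \<Rightarrow>\<^sub>0 int poly) \<Rightarrow> ((laurent \<times> (tangle \<Rightarrow>\<^sub>0 int poly)) \<Rightarrow>\<^sub>0 int) set" where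
  "to_Rf x \<equiv> pure_tensor R0_emb (VTL n) 1 x"

lemma to_Rf_in: "x \<in> carrier (VTL n) \<Longrightarrow> to_Rf x \<in> carrier (VTL_Rf n)"
  unfolding VTL_Rf_def by (rule ext.pt_closed)

lemma to_Rf_mult: "x \<in> carrier (VTL n) \<Longrightarrow> y \<in> carrier (VTL n) \<Longrightarrow>
    to_Rf x \<otimes>\<^bsub>VTL_Rf n\<^esub> to_Rf y = to_Rf (x \<otimes>\<^bsub>VTL n\<^esub> y)"
  unfolding VTL_Rf_def by (simp add: ext.pt_mult)

lemma to_Rf_one: "to_Rf \<one>\<^bsub>VTL n\<^esub> = \<one>\<^bsub>VTL_Rf n\<^esub>"
  unfolding VTL_Rf_def by (rule ext.pt_one)

text \<open>The balancing relation moves a scalar across the tensor sign; this is where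
  \<open>z\<close> turns into \<open>-A^2 - A^-2\<close>.\<close>

lemma to_Rf_smult: "x \<in> carrier (VTL n) \<Longrightarrow> to_Rf (r \<odot>\<^bsub>VTL n\<^esub> x) = R0_emb r \<odot>\<^bsub>VTL_Rf n\<^esub> to_Rf x"
  unfolding VTL_Rf_def using ext.pt_balance[of x n 1 r] by (simp add: ext.smult_pt)

lemma E_single_in: "i \<in> {1..n - 1} \<Longrightarrow> tangle_single (E_tangle n i) \<in> carrier (VTL n)"
  and v_single_in: "i \<in> {1..n - 1} \<Longrightarrow> tangle_single (v_tangle n i) \<in> carrier (VTL n)"
  by (simp_all add: tangle_single_in E_tangle_in v_tangle_in)

lemma E_elt_in: "i \<in> {1..n - 1} \<Longrightarrow> E_elt i \<in> carrier (VTL_Rf n)"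
  and v_elt_in: "i \<in> {1..n - 1} \<Longrightarrow> v_elt i \<in> carrier (VTL_Rf n)"
  by (simp_all add: tangle_elt_def to_Rf_in E_single_in v_single_in)

lemma E_elt_square:
  "i \<in> {1..n - 1} \<Longrightarrow> E_elt i \<otimes>\<^bsub>VTL_Rf n\<^esub> E_elt i = (- A_pow 2 - A_pow (-2)) \<odot>\<^bsub>VTL_Rf n\<^esub> E_elt i"
  by (simp add: tangle_elt_def to_Rf_mult E_single_in VTL_e_square to_Rf_smult R0_emb_z)

lemma v_elt_square: "i \<in> {1..n - 1} \<Longrightarrow> v_elt i \<otimes>\<^bsub>VTL_Rf n\<^esub> v_elt i = \<one>\<^bsub>VTL_Rf n\<^esub>"
  by (simp add: tangle_elt_def to_Rf_mult v_single_in VTL_v_square to_Rf_one)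

lemma VTL_Rf_far:
  assumes i: "i \<in> {1..n - 1}" and j: "j \<in> {1..n - 1}" and "\<bar>int i - int j\<bar> \<ge> 2"
  shows "E_elt i \<otimes>\<^bsub>VTL_Rf n\<^esub> E_elt j = E_elt j \<otimes>\<^bsub>VTL_Rf n\<^esub> E_elt i"
    and "v_elt i \<otimes>\<^bsub>VTL_Rf n\<^esub> v_elt j = v_elt j \<otimes>\<^bsub>VTL_Rf n\<^esub> v_elt i"
    and "v_elt i \<otimes>\<^bsub>VTL_Rf n\<^esub> E_elt j = E_elt j \<otimes>\<^bsub>VTL_Rf n\<^esub> v_elt i"
  using VTL_far[OF assms] E_single_in[OF i] E_single_in[OF j] v_single_in[OF i] v_single_in[OF j]
  by (simp_all add: tangle_elt_def to_Rf_mult)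

text \<open>The last identity is bracketed so that the product of the two swaps is a single element
  intertwining \<open>E_i\<close> with \<open>E_j\<close>, the form required by
  \<open>affine_intertwine\<close>.\<close>

lemma VTL_Rf_near:
  assumes i: "i \<in> {1..n - 1}" and j: "j \<in> {1..n - 1}" and "\<bar>int i - int j\<bar> = 1"
  shows "E_elt i \<otimes>\<^bsub>VTL_Rf n\<^esub> E_elt j \<otimes>\<^bsub>VTL_Rf n\<^esub> E_elt i = E_elt i"
    and "v_elt i \<otimes>\<^bsub>VTL_Rf n\<^esub> v_elt j \<otimes>\<^bsub>VTL_Rf n\<^esub> v_elt i = v_elt j \<otimes>\<^bsub>VTL_Rf n\<^esub> v_elt i \<otimes>\<^bsub>VTL_Rf n\<^esub> v_elt j"
    and "v_elt i \<otimes>\<^bsub>VTL_Rf n\<^esub> v_elt j \<otimes>\<^bsub>VTL_Rf n\<^esub> E_elt i = E_elt j \<otimes>\<^bsub>VTL_Rf n\<^esub> (v_elt i \<otimes>\<^bsub>VTL_Rf n\<^esub> v_elt j)"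
proof -
  note in' = E_single_in[OF i] E_single_in[OF j] v_single_in[OF i] v_single_in[OF j]
  show "E_elt i \<otimes>\<^bsub>VTL_Rf n\<^esub> E_elt j \<otimes>\<^bsub>VTL_Rf n\<^esub> E_elt i = E_elt i"
    "v_elt i \<otimes>\<^bsub>VTL_Rf n\<^esub> v_elt j \<otimes>\<^bsub>VTL_Rf n\<^esub> v_elt i = v_elt j \<otimes>\<^bsub>VTL_Rf n\<^esub> v_elt i \<otimes>\<^bsub>VTL_Rf n\<^esub> v_elt j"
    using VTL_near[OF assms] in' by (simp_all add: tangle_elt_def to_Rf_mult)
  show "v_elt i \<otimes>\<^bsub>VTL_Rf n\<^esub> v_elt j \<otimes>\<^bsub>VTL_Rf n\<^esub> E_elt i = E_elt j \<otimes>\<^bsub>VTL_Rf n\<^esub> (v_elt i \<otimes>\<^bsub>VTL_Rf n\<^esub> v_elt j)"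
    using VTL_near(3)[OF assms] in' by (simp add: tangle_elt_def to_Rf_mult VTL.m_assoc)
qed

definition sigma_image :: "nat \<Rightarrow> ((laurent \<times> (tangle \<Rightarrow>\<^sub>0 int poly)) \<Rightarrow>\<^sub>0 int) set" where
  "sigma_image i = (- A_pow (-2)) \<odot>\<^bsub>VTL_Rf n\<^esub> \<one>\<^bsub>VTL_Rf n\<^esub> \<oplus>\<^bsub>VTL_Rf n\<^esub> (- A_pow (-4)) \<odot>\<^bsub>VTL_Rf n\<^esub> E_elt i"

definition sigma_image_inv :: "nat \<Rightarrow> ((laurent \<times> (tangle \<Rightarrow>\<^sub>0 int poly)) \<Rightarrow>\<^sub>0 int) set" where
  "sigma_image_inv i = (- A_pow 2) \<odot>\<^bsub>VTL_Rf n\<^esub> \<one>\<^bsub>VTL_Rf n\<^esub> \<oplus>\<^bsub>VTL_Rf n\<^esub> (- A_pow 4) \<odot>\<^bsub>VTL_Rf n\<^esub> E_elt i"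

lemma sigma_image_in: "i \<in> {1..n - 1} \<Longrightarrow> sigma_image i \<in> carrier (VTL_Rf n)"
  and sigma_image_inv_in: "i \<in> {1..n - 1} \<Longrightarrow> sigma_image_inv i \<in> carrier (VTL_Rf n)"
  by (simp_all add: sigma_image_def sigma_image_inv_def E_elt_in)

text \<open>The coefficient of \<open>E_i\<close> is \<open>A^2 + A^-2 + z\<close>, which vanishes
  for the embedded \<open>z\<close>; the unit has coefficient \<open>A^-2 A^2 = 1\<close>.\<close>

lemma sigma_image_inverse:
  assumes "i \<in> {1..n - 1}"
  shows "sigma_image i \<otimes>\<^bsub>VTL_Rf n\<^esub> sigma_image_inv i = \<one>\<^bsub>VTL_Rf n\<^esub>" and "sigma_image_inv i \<otimes>\<^bsub>VTL_Rf n\<^esub> sigma_image i = \<one>\<^bsub>VTL_Rf n\<^esub>"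
  unfolding sigma_image_def sigma_image_inv_def
  by (rule VTL_Rf.affine_inverse[OF E_elt_in[OF assms] E_elt_square[OF assms]];
      simp add: A_pow_mult A_pow_0 algebra_simps)+

text \<open>The required vanishing reads \<open>A^-4 + A^-6 z + A^-8 = 0\<close>, and
  \<open>A^-6 z\<close> equals \<open>-A^-4 - A^-8\<close>.\<close>

lemma sigma_image_braid:
  assumes i: "i \<in> {1..n - 1}" and j: "j \<in> {1..n - 1}" and ij: "\<bar>int i - int j\<bar> = 1"
  shows "sigma_image i \<otimes>\<^bsub>VTL_Rf n\<^esub> sigma_image j \<otimes>\<^bsub>VTL_Rf n\<^esub> sigma_image i = sigma_image j \<otimes>\<^bsub>VTL_Rf n\<^esub> sigma_image i \<otimes>\<^bsub>VTL_Rf n\<^esub> sigma_image j"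
proof -
  have ji: "\<bar>int j - int i\<bar> = 1" using ij by simp
  show ?thesis
    unfolding sigma_image_def
    by (rule VTL_Rf.affine_braid[OF E_elt_in[OF i] E_elt_in[OF j] E_elt_square[OF i] E_elt_square[OF j]
          VTL_Rf_near(1)[OF i j ij] VTL_Rf_near(1)[OF j i ji]])
      (simp add: A_pow_mult algebra_simps)
qed

definition gen_image :: "vb_gen \<Rightarrow> ((laurent \<times> (tangle \<Rightarrow>\<^sub>0 int poly)) \<Rightarrow>\<^sub>0 int) set" where
  "gen_image x = (case x of Sigma_gen i \<Rightarrow> sigma_image i | Tau_gen i \<Rightarrow> v_elt i)"

definition gen_image_inv :: "vb_gen \<Rightarrow> ((laurent \<times> (tangle \<Rightarrow>\<^sub>0 int poly)) \<Rightarrow>\<^sub>0 int) set" where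
  "gen_image_inv x = (case x of Sigma_gen i \<Rightarrow> sigma_image_inv i | Tau_gen i \<Rightarrow> v_elt i)"

lemma word_eval_vb_rels:
  assumes "(l, r) \<in> vb_rels n"
  shows "word_eval (VTL_Rf n) gen_image gen_image_inv l = word_eval (VTL_Rf n) gen_image gen_image_inv r"
proof -
  note [simp] = gen_image_def sigma_image_in v_elt_in
  from assms consider
    (tau) i where "i \<in> {1..n - 1}" "l = [tu i, tu i]" "r = []"
  | (far) i j where "i \<in> {1..n - 1}" "j \<in> {1..n - 1}" "\<bar>int i - int j\<bar> \<ge> 2"
      "(l, r) \<in> {([sg i, sg j], [sg j, sg i]), ([tu i, tu j], [tu j, tu i]), ([tu i, sg j], [sg j, tu i])}"
  | (near) i j where "i \<in> {1..n - 1}" "j \<in> {1..n - 1}" "\<bar>int i - int j\<bar> = 1"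
      "(l, r) \<in> {([sg i, sg j, sg i], [sg j, sg i, sg j]), ([tu i, tu j, tu i], [tu j, tu i, tu j]),
         ([tu i, tu j, sg i], [sg j, tu i, tu j])}"
    unfolding vb_rels_def by blast
  then show ?thesis
  proof cases
    case tau
    then show ?thesis using v_elt_square[of i] by simp
  next
    case far
    note ij = far(1-3)
    have "sigma_image i \<otimes>\<^bsub>VTL_Rf n\<^esub> sigma_image j = sigma_image j \<otimes>\<^bsub>VTL_Rf n\<^esub> sigma_image i"
      unfolding sigma_image_def
      by (rule VTL_Rf.affine_commute[OF E_elt_in[OF far(1)] E_elt_in[OF far(2)] VTL_Rf_far(1)[OF ij]])
    \<comment> \<open>Commutation is the case of \<open>affine_intertwine\<close> in which both
      intertwined elements are \<open>E_j\<close>.\<close>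
    moreover have "v_elt i \<otimes>\<^bsub>VTL_Rf n\<^esub> sigma_image j = sigma_image j \<otimes>\<^bsub>VTL_Rf n\<^esub> v_elt i"
      unfolding sigma_image_def
      by (rule VTL_Rf.affine_intertwine[OF E_elt_in[OF far(2)] E_elt_in[OF far(2)] v_elt_in[OF far(1)] VTL_Rf_far(3)[OF ij]])
    ultimately show ?thesis using far VTL_Rf_far(2)[OF ij] by auto
  next
    case near
    note ij = near(1-3)
    \<comment> \<open>The mixed relation is intertwining by the product of the two swaps, which
      extends from \<open>E_i\<close> and \<open>E_j\<close> to affine expressions in them.\<close>
    have "v_elt i \<otimes>\<^bsub>VTL_Rf n\<^esub> v_elt j \<otimes>\<^bsub>VTL_Rf n\<^esub> sigma_image i = sigma_image j \<otimes>\<^bsub>VTL_Rf n\<^esub> (v_elt i \<otimes>\<^bsub>VTL_Rf n\<^esub> v_elt j)"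
      unfolding sigma_image_def
      by (rule VTL_Rf.affine_intertwine[OF E_elt_in[OF near(1)] E_elt_in[OF near(2)]
            VTL_Rf.m_closed[OF v_elt_in[OF near(1)] v_elt_in[OF near(2)]] VTL_Rf_near(3)[OF ij]])
    then show ?thesis
      using near sigma_image_braid[OF ij] VTL_Rf_near(2)[OF ij] by (auto simp: VTL_Rf.m_assoc)
  qed
qed

end

theorem theorem2p5:
  fixes n :: nat
  assumes "n \<ge> 1"
  shows "\<exists>\<rho> \<in> algebra_hom (Rf_VB n) (VTL_Rf n).
    \<forall>i \<in> {1..n - 1}.
      \<rho> (Poly_Mapping.single (vb_sigma n i) 1) =
        ((- A_pow (-2)) \<odot>\<^bsub>VTL_Rf n\<^esub> \<one>\<^bsub>VTL_Rf n\<^esub>)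
          \<ominus>\<^bsub>VTL_Rf n\<^esub> (A_pow (-4) \<odot>\<^bsub>VTL_Rf n\<^esub> tangle_elt n (E_tangle n i))
    \<and> \<rho> (Poly_Mapping.single (vb_tau n i) 1) = tangle_elt n (v_tangle n i)"
proof -
  let ?X = "vb_gens n" and ?R = "vb_rels n" and ?N = "VTL_Rf n"
  have gens: "x \<in> ?X \<Longrightarrow> \<exists>i\<in>{1..n - 1}. x = Sigma_gen i \<or> x = Tau_gen i" for x
    by (auto simp: vb_gens_def)
  obtain \<phi> where \<phi>: "\<phi> \<in> hom (presented_group ?X ?R) ?N" "\<phi> \<one>\<^bsub>presented_group ?X ?R\<^esub> = \<one>\<^bsub>?N\<^esub>"
    and gen: "\<And>x. x \<in> ?X \<Longrightarrow> \<phi> (pres_gen ?X ?R x) = gen_image n x"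
  proof (rule presented_group_hom[of ?N ?X "gen_image n" "gen_image_inv n" ?R])
    fix x assume "x \<in> ?X"
    then obtain i where "i \<in> {1..n - 1}" "x = Sigma_gen i \<or> x = Tau_gen i" using gens by blast
    then show "gen_image n x \<in> carrier ?N" "gen_image_inv n x \<in> carrier ?N"
      "gen_image n x \<otimes>\<^bsub>?N\<^esub> gen_image_inv n x = \<one>\<^bsub>?N\<^esub>"
      "gen_image_inv n x \<otimes>\<^bsub>?N\<^esub> gen_image n x = \<one>\<^bsub>?N\<^esub>"
      by (auto simp: gen_image_def gen_image_inv_def sigma_image_in sigma_image_inv_in v_elt_in sigma_image_inverse v_elt_square)
  qed (use VTL_Rf.monoid_axioms word_eval_vb_rels in blast)+
  obtain \<rho> where \<rho>: "\<rho> \<in> algebra_hom (monoid_algebra (presented_group ?X ?R)) ?N"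
    "\<And>g. g \<in> carrier (presented_group ?X ?R) \<Longrightarrow> \<rho> (Poly_Mapping.single g 1) = \<phi> g"
    using VTL_Rf.monoid_algebra_hom[OF monoid_presented_group \<phi>] by blast
  have gen_eq: "\<rho> (Poly_Mapping.single (pres_gen ?X ?R x) 1) = gen_image n x" if "x \<in> ?X" for x
    using \<rho>(2) gen that presented_group_class_in[of "[(True, x)]" ?X ?R] by (simp add: pres_gen_def)
  show ?thesis
  proof (intro bexI[of _ \<rho>] ballI conjI)
    fix i assume i: "i \<in> {1..n - 1}"
    have "\<rho> (Poly_Mapping.single (vb_sigma n i) 1) = sigma_image n i"
      using gen_eq[of "Sigma_gen i"] i by (simp add: vb_sigma_def gen_image_def vb_gens_def)
    then show "\<rho> (Poly_Mapping.single (vb_sigma n i) 1) =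
        ((- A_pow (-2)) \<odot>\<^bsub>VTL_Rf n\<^esub> \<one>\<^bsub>VTL_Rf n\<^esub>)
          \<ominus>\<^bsub>VTL_Rf n\<^esub> (A_pow (-4) \<odot>\<^bsub>VTL_Rf n\<^esub> tangle_elt n (E_tangle n i))"
      \<comment> \<open>\<open>sigma_image\<close> is a sum with a negative coefficient, as the
        affine lemmas require; here it becomes the subtraction in the claim.\<close>
      using E_elt_in[OF i] by (simp add: sigma_image_def a_minus_def VTL_Rf.smult_minus_left)
    show "\<rho> (Poly_Mapping.single (vb_tau n i) 1) = tangle_elt n (v_tangle n i)"
      using gen_eq[of "Tau_gen i"] i by (simp add: vb_tau_def gen_image_def vb_gens_def)
  next
    show "\<rho> \<in> algebra_hom (Rf_VB n) ?N" using \<rho>(1) by (simp add: Rf_VB_def VB_def)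
  qed
qed

end
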